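(* Let $n\ge2$, $0\le\beta<n$, $\alpha,\gamma\in\mathbb{R}$, $1\le p_1,p_2,q<\infty$, $1\le s<\infty$, with $q\le p_2$, $\frac{\gamma+n}{p_2}=\frac{\alpha+n}{p_1}-\beta$ and $\frac1{p_2}+1=\frac1s+\frac1{p_1}$. Let $\Phi$ be a measurable function on $\mathbb{R}^n$. Then, for all functions $f$ for which the respective right-hand side is finite: (a) $\displaystyle \|H_{\Phi,\beta}f\|_{L^{p_2}_{\rm rad}L^{q}_{\rm ang}(\mathbb{R}^n,r^\gamma)}\le\|\Phi\|_{L^{q}_{\rm ang}L^{s}_{\rm rad}(\mathbb{R}^n,\,r^{\frac{(\gamma+n)s}{p_2}-n})}\,\|f\|_{L^{1}_{\rm ang}L^{p_1}_{\rm rad}(\mathbb{R}^n,r^\alpha)}$; (b) $\displaystyle \|H_{\Phi,\beta}f\|_{L^{p_2}_{\rm rad}L^{q}_{\rm ang}(\mathbb{R}^n,r^\gamma)}\le\|\Phi\|_{L^{q}_{\rm ang}L^{s}_{\rm rad}(\mathbb{R}^n,\,r^{\frac{(\gamma+n)s}{p_2}-n})}\,\|f\|_{L^{p_1}_{\rm rad}L^{q}_{\rm ang}(\mathbb{R}^n,r^\alpha)}$.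
   Context: $S^{n-1}$ is the unit sphere of $\mathbb{R}^n$ with surface Lebesgue measure $d\sigma$. For $1\le p,\tilde p<\infty$ and a weight $w$ on $(0,\infty)$, $$\|f\|_{L^{p}_{\rm rad}L^{\tilde p}_{\rm ang}(\mathbb{R}^n,w)}=\Big(\int_0^\infty\Big(\int_{S^{n-1}}|f(r\theta)|^{\tilde p}d\sigma(\theta)\Big)^{p/\tilde p}r^{n-1}w(r)\,dr\Big)^{1/p},$$ $$\|f\|_{L^{\tilde p}_{\rm ang}L^{p}_{\rm rad}(\mathbb{R}^n,w)}=\Big(\int_{S^{n-1}}\Big(\int_0^\infty|f(r\theta)|^{p}r^{n-1}w(r)\,dr\Big)^{\tilde p/p}d\sigma(\theta)\Big)^{1/\tilde p};$$ $r^\gamma$ denotes the weight $w(r)=r^\gamma$. The $n$-dimensional fractional Hausdorff operator is $$H_{\Phi,\beta}f(x)=\int_{\mathbb{R}^n}\frac{\Phi(x|y|^{-1})}{|y|^{n-\beta}}f(y)\,dy .$$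
   Formalization: Part (b) is proved with the extra factor σ(S^{n-1})^{1-1/q} on the right-hand side; with constant 1 it is false, e.g. n=2, α=β=γ=0, p_1=p_2=q=2, s=1, Φ=1 on 1≤|x|≤2, f=1/|x| on 1≤|x|≤4. *)

theory Defs
  imports "HOL-Analysis.Analysis"
begin

text \<open>
  Surface Lebesgue measure (not normalised) on the unit sphere of a \<open>d\<close>-dimensional Euclidean
  space, as the cone measure: \<open>\<sigma>(A) = d \<cdot> \<lambda>{t\<theta> | 0 < t < 1, \<theta> \<in> A}\<close> for a Borel set
  \<open>A\<close> of unit vectors. This is the measure \<open>\<sigma>\<close> of the polar coordinate formula
  \<open>dx = r\<^sup>d\<^sup>-\<^sup>1 dr d\<sigma>\<close>. Note that \<open>sgn x = x /\<^sub>R norm x\<close>.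
\<close>

definition sphere_measure :: "'a::euclidean_space measure" where
  "sphere_measure =
     scale_measure (of_nat DIM('a))
       (distr (restrict_space lborel (ball 0 1 - {0})) (restrict_space borel (sphere 0 1)) sgn)"

lemma space_sphere_measure: "space (sphere_measure :: 'a::euclidean_space measure) = sphere 0 1"
  by (simp add: sphere_measure_def space_scale_measure space_restrict_space)

lemma sets_sphere_measure:
  "sets (sphere_measure :: 'a::euclidean_space measure) = sets (restrict_space borel (sphere 0 1))"
  by (simp add: sphere_measure_def)

lemma emeasure_sphere_measure:
  fixes A :: "'a::euclidean_space set"
  assumes "A \<in> sets borel" "A \<subseteq> sphere 0 1"
  shows "emeasure sphere_measure A =
           of_nat DIM('a) * emeasure lborel {x. 0 < norm x \<and> norm x < 1 \<and> sgn x \<in> A}"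
proof -
  let ?M = "restrict_space lborel (ball 0 1 - {0} :: 'a set)"
  have "(\<lambda>x::'a. x /\<^sub>R norm x) \<in> borel_measurable borel"
    by measurable
  then have "(sgn :: 'a \<Rightarrow> 'a) \<in> borel_measurable borel"
    by (simp add: sgn_div_norm[abs_def])
  then have "(sgn :: 'a \<Rightarrow> 'a) \<in> borel_measurable ?M"
    by (intro measurable_restrict_space1) simp
  then have sgn: "sgn \<in> measurable ?M (restrict_space borel (sphere 0 1))"
    by (intro measurable_restrict_space2) (auto simp: space_restrict_space norm_sgn)
  have A: "A \<in> sets (restrict_space borel (sphere 0 1))"
    using assms by (auto simp: sets_restrict_space)
  have eq: "sgn -` A \<inter> space ?M = {x. 0 < norm x \<and> norm x < 1 \<and> sgn x \<in> A}"
    by (auto simp: space_restrict_space)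
  have "emeasure ?M (sgn -` A \<inter> space ?M) = emeasure lborel (sgn -` A \<inter> space ?M)"
    by (rule emeasure_restrict_space) (auto simp: space_restrict_space)
  then have "emeasure ?M (sgn -` A \<inter> space ?M) =
      emeasure lborel {x. 0 < norm x \<and> norm x < 1 \<and> sgn x \<in> A}"
    by (simp only: eq)
  then show ?thesis
    by (simp only: sphere_measure_def emeasure_scale_measure emeasure_distr[OF sgn A])
qed

text \<open>Powers \<open>x\<^sup>a\<close> of extended nonnegative numbers; only meant for exponents \<open>a > 0\<close>.\<close>

definition ennpowr :: "ennreal \<Rightarrow> real \<Rightarrow> ennreal" where
  "ennpowr x a = (if x = \<infinity> then \<infinity> else ennreal (enn2real x powr a))"

text \<open>
  The mixed norms take values in \<open>[0,\<infinity>]\<close>; membership in the space is finiteness of the norm. In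
  \<open>rad_ang_norm p q w f\<close> and \<open>ang_rad_norm q p w f\<close>, \<open>p\<close> is the radial and \<open>q\<close> the angular
  exponent, listed from the outer to the inner norm.
\<close>

definition rad_ang_norm ::
  "real \<Rightarrow> real \<Rightarrow> (real \<Rightarrow> real) \<Rightarrow> ('a::euclidean_space \<Rightarrow> 'b::real_normed_vector) \<Rightarrow> ennreal" where
  "rad_ang_norm p q w f =
     ennpowr
       (\<integral>\<^sup>+r\<in>{0<..}.
          ennpowr (\<integral>\<^sup>+\<theta>. ennreal (norm (f (r *\<^sub>R \<theta>)) powr q) \<partial>sphere_measure) (p / q)
          * ennreal (r ^ (DIM('a) - 1) * w r) \<partial>lborel)
       (1 / p)"

definition ang_rad_norm ::
  "real \<Rightarrow> real \<Rightarrow> (real \<Rightarrow> real) \<Rightarrow> ('a::euclidean_space \<Rightarrow> 'b::real_normed_vector) \<Rightarrow> ennreal" where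
  "ang_rad_norm q p w f =
     ennpowr
       (\<integral>\<^sup>+\<theta>.
          ennpowr
            (\<integral>\<^sup>+r\<in>{0<..}. ennreal (norm (f (r *\<^sub>R \<theta>)) powr p * r ^ (DIM('a) - 1) * w r) \<partial>lborel)
            (q / p)
          \<partial>sphere_measure)
       (1 / q)"

definition hausdorff_integrand ::
  "('a::euclidean_space \<Rightarrow> complex) \<Rightarrow> real \<Rightarrow> ('a \<Rightarrow> complex) \<Rightarrow> 'a \<Rightarrow> 'a \<Rightarrow> complex" where
  "hausdorff_integrand \<Phi> \<beta> f x y =
     \<Phi> (x /\<^sub>R norm y) / of_real (norm y powr (real DIM('a) - \<beta>)) * f y"

text \<open>
  \<open>H\<^bsub>\<Phi>,\<beta>\<^esub>f(x)\<close> is meaningful only where the integrand is Lebesgue integrable (the Bochner integral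
  is \<open>0\<close> elsewhere), so statements about it should also assert this for almost every \<open>x\<close>.
\<close>

definition hausdorff_op ::
  "('a::euclidean_space \<Rightarrow> complex) \<Rightarrow> real \<Rightarrow> ('a \<Rightarrow> complex) \<Rightarrow> 'a \<Rightarrow> complex" where
  "hausdorff_op \<Phi> \<beta> f x = (\<integral>y. hausdorff_integrand \<Phi> \<beta> f x y \<partial>lebesgue)"

text \<open>
  The factor \<open>\<sigma>(S)\<^bsup>1 - 1/q\<^esup>\<close>, the norm of the embedding of \<open>L\<^sup>q\<close> into \<open>L\<^sup>1\<close> on the unit sphere.
  It cannot be dropped from the estimate by the radial-angular norm of \<open>f\<close>, even for radial
  \<open>\<Phi>\<close> and \<open>f\<close>. In dimension 2 with \<open>\<beta> = \<alpha> = \<gamma> = 0\<close>, \<open>p\<^sub>1 = p\<^sub>2 = q = 2\<close>, \<open>s = 1\<close>, take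
  \<open>\<Phi>(x) = 1\<close> for \<open>1 \<le> |x| \<le> 2\<close> and \<open>f(x) = 1/|x|\<close> for \<open>1 \<le> |x| \<le> 4\<close> (and \<open>0\<close> otherwise): then
  the square of the left-hand side is at least \<open>8\<pi>\<^sup>3 ln 2\<close>, while the square of the product of the
  two norms on the right is \<open>8\<pi>\<^sup>2 ln 2\<close>.
\<close>

definition sphere_embedding_const :: "'a::euclidean_space itself \<Rightarrow> real \<Rightarrow> ennreal" where
  "sphere_embedding_const _ q =
     ennreal (measure (sphere_measure :: 'a measure) (sphere 0 1) powr (1 - 1 / q))"

end

theory Submission
  imports Defs
begin

text \<open>
  In polar coordinates \<open>H f(\<rho>\<theta>) = \<integral> \<Phi>((\<rho>/r)\<theta>) r\<^sup>\<beta> F(r) dr/r\<close> with \<open>F(r) = \<integral> f(r\<omega>) d\<sigma>(\<omega>)\<close>, so for each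
  direction \<open>\<theta>\<close> the operator is a convolution on the multiplicative group \<open>(0,\<infinity>)\<close>. Since \<open>q \<le> p\<^sub>2\<close>,
  Minkowski's inequality moves the radial norm inside the angular one; Young's inequality then bounds
  the radial norm for each \<open>\<theta>\<close> by the radial norm of \<open>\<Phi>\<close> along \<open>\<theta>\<close> times that of \<open>F\<close>, and the latter is
  estimated by Minkowski's inequality in (a) and by Hoelder's inequality on the sphere in (b).

  A Lebesgue measurable \<open>\<Phi>\<close> may be replaced by a Borel function because for almost every \<open>\<theta>\<close> both
  agree almost everywhere on the ray through \<open>\<theta>\<close>, and \<open>H f(\<rho>\<theta>)\<close> only sees \<open>\<Phi>\<close> on that ray.
\<close>

section \<open>Powers of extended nonnegative numbers\<close>

text \<open>The obstacle is that \<open>hausdorff_op\<close> carries no information where its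
  integrand is not integrable, while integrability almost everywhere is part of the claim. All
  estimates are therefore made for the integral K of the modulus, which has values in
  [0,\<infinity>], and the integral inequalities are needed without any finiteness assumption on
  their left-hand sides. A finite mixed norm of K forces K to be finite almost everywhere, and this
  is the integrability. With \<open>a = \<gamma> + n\<close> and \<open>b = \<alpha> + n\<close> as
  exponents against dr/r, the scaling hypothesis reads
  \<open>b / p\<^sub>1 = a / p\<^sub>2 + \<beta>\<close>: exactly the balance that lets the weight
  be shared between the two factors of the convolution. Since f enters only through its spherical
  integrals F, both estimates are consequences of one bound in which the angular exponent of f is 1.
  Raising this exponent to \<open>q\<close> costs a power of the total mass of the sphere, which is
  the origin of the constant in (b).\<close>

lemma ennpowr_ennreal: "0 \<le> x \<Longrightarrow> ennpowr (ennreal x) a = ennreal (x powr a)"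
  by (simp add: ennpowr_def)

lemma ennpowr_top [simp]: "ennpowr top a = top"
  by (simp add: ennpowr_def)

lemma ennpowr_zero [simp]: "ennpowr 0 a = 0"
  by (simp add: ennpowr_def)

lemma ennpowr_one [simp]: "ennpowr x 1 = x"
  by (cases x) (simp_all add: ennpowr_ennreal)

lemma ennpowr_eq_zero_iff [simp]: "ennpowr x a = 0 \<longleftrightarrow> x = 0"
  by (cases x) (simp_all add: ennpowr_ennreal ennreal_eq_0_iff)

lemma ennpowr_eq_top_iff [simp]: "ennpowr x a = top \<longleftrightarrow> x = top"
  by (cases x) (simp_all add: ennpowr_ennreal)

lemma ennpowr_mono: "x \<le> y \<Longrightarrow> 0 \<le> a \<Longrightarrow> ennpowr x a \<le> ennpowr y a"
  by (cases x; cases y) (simp_all add: ennpowr_ennreal powr_mono2 top_unique)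

lemma ennpowr_mult: "ennpowr (x * y) a = ennpowr x a * ennpowr y a"
proof (cases x; cases y)
  fix r t assume "0 \<le> r" "x = ennreal r" "0 \<le> t" "y = ennreal t"
  then show ?thesis
    by (simp add: ennpowr_ennreal powr_mult flip: ennreal_mult)
next
  fix r assume "0 \<le> r" "x = ennreal r" "y = top"
  then show ?thesis
    by (cases "r = 0") (simp_all add: ennpowr_ennreal ennreal_mult_top)
next
  fix r assume "0 \<le> r" "y = ennreal r" "x = top"
  then show ?thesis
    by (cases "r = 0") (simp_all add: ennpowr_ennreal ennreal_top_mult)
qed simp

lemma ennpowr_ennpowr: "ennpowr (ennpowr x a) b = ennpowr x (a * b)"
  by (cases x) (simp_all add: ennpowr_ennreal powr_powr)

lemma ennpowr_add:
  assumes "x \<noteq> 0" "x \<noteq> top"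
  shows "ennpowr x (a + b) = ennpowr x a * ennpowr x b"
  using assms by (cases x) (auto simp: ennpowr_ennreal powr_add simp flip: ennreal_mult)

lemma ennpowr_le_iff_le_root:
  assumes "0 < a"
  shows "ennpowr x a \<le> y \<longleftrightarrow> x \<le> ennpowr y (1 / a)"
  using assms ennpowr_mono[of "ennpowr x a" y "1 / a"] ennpowr_mono[of x "ennpowr y (1 / a)" a]
  by (auto simp: ennpowr_ennpowr)

lemma measurable_ennpowr [measurable (raw)]:
  assumes [measurable]: "f \<in> borel_measurable M"
  shows "(\<lambda>x. ennpowr (f x) a) \<in> borel_measurable M"
  unfolding ennpowr_def by measurable

section \<open>Pointwise convexity inequalities, in a form that can be integrated\<close>

lemma weighted_arith_geo_mean3:
  fixes a b c x y z :: real
  assumes "0 \<le> a" "0 \<le> b" "0 \<le> c" "a + b + c = 1" "0 < x" "0 < y" "0 < z"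
  shows "x powr a * y powr b * z powr c \<le> a * x + b * y + c * z"
proof -
  define M where "M = a * x + b * y + c * z"
  have "0 < a \<or> 0 < b \<or> 0 < c"
    using assms by linarith
  then have "0 < M"
    unfolding M_def using assms by (smt (verit) mult_nonneg_nonneg mult_pos_pos)
  \<comment> \<open>The bound \<open>ln t \<le> t - 1\<close> at the quotients by the weighted mean
    \<open>M\<close>: averaged with the weights, its right-hand sides add up to 0. Zero weights are
    allowed because Young's inequality produces them when one of its exponents is 1.\<close>
  have "a * ln (x / M) \<le> a * (x / M - 1)" "b * ln (y / M) \<le> b * (y / M - 1)"
    "c * ln (z / M) \<le> c * (z / M - 1)"
    using assms \<open>0 < M\<close> by (auto intro!: mult_left_mono ln_le_minus_one)
  moreover have "a * (x / M - 1) + b * (y / M - 1) + c * (z / M - 1)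
      = (a * x + b * y + c * z) / M - (a + b + c)"
    by (simp add: add_divide_distrib algebra_simps)
  ultimately have "a * ln (x / M) + b * ln (y / M) + c * ln (z / M) \<le> 0"
    using assms \<open>0 < M\<close> by (simp flip: M_def)
  then have "a * ln x + b * ln y + c * ln z \<le> (a + b + c) * ln M"
    using assms(5-) \<open>0 < M\<close> by (simp add: ln_div algebra_simps)
  then have "a * ln x + b * ln y + c * ln z \<le> ln M"
    unfolding assms(4) by simp
  then have "exp (a * ln x + b * ln y + c * ln z) \<le> M"
    using assms \<open>0 < M\<close> by (simp add: ln_ge_iff)
  then show ?thesis
    using assms by (simp add: powr_def M_def exp_add)
qed

text \<open>
  Tangent-line bounds are linear in the products that are to be integrated, so the inequalities of
  Hoelder, Minkowski and Young follow from them by integration; \<open>ennpowr_le_if_tangent_le\<close> then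
  chooses the best \<open>m\<close>.
\<close>

lemma powr_ge_tangent:
  fixes m u p :: real
  assumes "1 \<le> p" "0 \<le> m" "0 \<le> u"
  shows "p * m powr (p - 1) * u \<le> u powr p + (p - 1) * m powr p"
proof (cases "m = 0 \<or> u = 0")
  case False
  then have "(u powr p) powr (1 / p) * (m powr p) powr (1 - 1 / p)
      \<le> 1 / p * (u powr p) + (1 - 1 / p) * (m powr p)"
    using assms by (intro Youngs_inequality_0) auto
  moreover have "p * (1 - 1 / p) = p - 1"
    using assms by (simp add: field_simps)
  ultimately have "u * m powr (p - 1) \<le> 1 / p * (u powr p) + (1 - 1 / p) * (m powr p)"
    using assms False by (simp add: powr_powr)
  then have "p * (u * m powr (p - 1)) \<le> p * (1 / p * (u powr p) + (1 - 1 / p) * (m powr p))"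
    using assms by (intro mult_left_mono) auto
  also have "\<dots> = u powr p + (p - 1) * m powr p"
    using assms by (simp add: field_simps)
  finally show ?thesis
    by (simp add: mult_ac)
qed (use assms in auto)

text \<open>Homogenised form: the tangent bound at \<open>x / c\<close>, multiplied by
  \<open>c\<close>. The weight \<open>c\<close> is free; in the applications it is a density of
  total mass 1, so that the last summand integrates to \<open>(p - 1) * m powr p\<close>.\<close>

lemma ennpowr_ge_tangent:
  assumes "1 \<le> p" "0 \<le> m" "0 < c" "c < top"
  shows "ennreal (p * m powr (p - 1)) * x
    \<le> ennpowr x p * ennpowr c (1 - p) + ennreal ((p - 1) * m powr p) * c"
proof (cases x)
  case (real r)
  obtain d where d: "c = ennreal d" "0 < d"
    using assms by (cases c) auto
  have "p * m powr (p - 1) * (r / d) * d \<le> ((r / d) powr p + (p - 1) * m powr p) * d"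
    using assms d real by (intro mult_right_mono powr_ge_tangent) auto
  also have "\<dots> = r powr p * d powr (1 - p) + (p - 1) * m powr p * d"
    using d real by (simp add: powr_divide powr_diff field_simps)
  finally show ?thesis
    using assms d real by (simp add: ennpowr_ennreal flip: ennreal_mult ennreal_plus)
next
  case top
  then show ?thesis
    using assms by (auto simp: ennreal_top_mult top_unique less_top)
qed

text \<open>For finite positive values \<open>g\<close>, \<open>h\<close> of the two factors this is
  the weighted mean inequality for \<open>g powr s * h powr r / m powr p\<close>,
  \<open>g powr s\<close> and \<open>h powr r\<close> with weights \<open>1 / p\<close>,
  \<open>1 / s - 1 / p\<close> and \<open>1 / r - 1 / p\<close>; their geometric mean is
  \<open>g * h / m\<close>. It replaces the three-factor Hoelder inequality in the classical proof
  of Young's inequality.\<close>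

lemma ennpowr_ge_young_tangent:
  assumes "1 \<le> r" "1 \<le> s" "r \<le> p" "s \<le> p" "1 / p + 1 = 1 / s + 1 / r" "0 \<le> m"
  shows "ennreal (p * m powr (p - 1)) * (x * y)
    \<le> ennpowr x s * ennpowr y r
      + (ennreal (m powr p * (p / s - 1)) * ennpowr x s + ennreal (m powr p * (p / r - 1)) * ennpowr y r)"
\<comment> \<open>If a factor is 0, so is the left-hand side; if one is infinite and the other is
  not 0, the product of powers on the right is already infinite.\<close>
proof (cases "x = 0 \<or> y = 0 \<or> x = top \<or> y = top")
  case True
  then show ?thesis
    by (auto simp: ennreal_top_mult ennreal_mult_top top_unique)
next
  case False
  then obtain g h where g: "x = ennreal g" "0 < g" and h: "y = ennreal h" "0 < h"
    by (cases x; cases y) (auto simp: less_le)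
  have s1: "0 \<le> p / s - 1" "0 \<le> p / r - 1"
    using assms by auto
  have "p * m powr (p - 1) * (g * h)
    \<le> g powr s * h powr r + (m powr p * (p / s - 1) * g powr s + m powr p * (p / r - 1) * h powr r)"
  proof (cases "m = 0")
    case False
    then have m: "0 < m" using assms by simp
    have le: "1 / p \<le> 1 / s" "1 / p \<le> 1 / r"
      using assms by (auto intro: divide_left_mono)
    let ?x = "g powr s * h powr r / m powr p"
    have "?x powr (1 / p) * (g powr s) powr (1 / s - 1 / p) * (h powr r) powr (1 / r - 1 / p)
      \<le> 1 / p * ?x + (1 / s - 1 / p) * g powr s + (1 / r - 1 / p) * h powr r"
      using assms g h m le by (intro weighted_arith_geo_mean3) auto
    moreover have "(g powr s) powr (1 / s - 1 / p) = g / g powr (s / p)"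
      "(h powr r) powr (1 / r - 1 / p) = h / h powr (r / p)"
      using assms g h by (simp_all add: powr_powr right_diff_distrib powr_diff)
    moreover have "?x powr (1 / p) = g powr (s / p) * h powr (r / p) / m"
      using assms g h m by (simp add: powr_divide powr_mult powr_powr)
    ultimately have "g * h / m \<le> 1 / p * ?x + (1 / s - 1 / p) * g powr s + (1 / r - 1 / p) * h powr r"
      using g h m by simp
    then have "p * m powr p * (g * h / m)
      \<le> p * m powr p * (1 / p * ?x + (1 / s - 1 / p) * g powr s + (1 / r - 1 / p) * h powr r)"
      using assms m by (intro mult_left_mono) auto
    also have "\<dots> = g powr s * h powr r + (m powr p * (p / s - 1) * g powr s + m powr p * (p / r - 1) * h powr r)"
      using assms m by (simp add: field_simps)
    also have "p * m powr p * (g * h / m) = p * m powr (p - 1) * (g * h)"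
      using m by (simp add: powr_diff)
    finally show ?thesis .
  qed (use assms g h in simp)
  then show ?thesis
    using assms g h s1 by (simp add: ennpowr_ennreal flip: ennreal_mult ennreal_plus)
qed

lemma ennpowr_le_if_tangent_le:
  assumes "1 \<le> p"
    and le: "\<And>m. 0 \<le> m \<Longrightarrow> ennreal (p * m powr (p - 1)) * x \<le> y + ennreal ((p - 1) * m powr p)"
  shows "ennpowr x p \<le> y"
proof (cases x)
  case (real r)
  have "r powr (p - 1) * r = r powr p"
    using real assms by (cases "r = 0") (simp_all add: powr_diff)
  then have "p * r powr (p - 1) * r = r powr p + (p - 1) * r powr p"
    by (simp only: mult.assoc) (simp add: algebra_simps)
  \<comment> \<open>The optimal tangent point is \<open>m = r\<close>; the excess term is finite and
    cancels.\<close>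
  then have "ennreal (r powr p) + ennreal ((p - 1) * r powr p) \<le> y + ennreal ((p - 1) * r powr p)"
    using le[of r] real assms by (simp flip: ennreal_mult ennreal_plus)
  then show ?thesis
    using real by (simp add: ennpowr_ennreal ennreal_add_left_cancel_le add.commute[of _ "ennreal ((p - 1) * r powr p)"])
next
  case top
  \<comment> \<open>At infinity any positive tangent point works.\<close>
  then show ?thesis
    using le[of 1] assms by (simp add: ennreal_mult_top top_unique)
qed

section \<open>Integral inequalities\<close>

text \<open>Jensen's inequality for the normalised measure: the weight in the tangent bound is the
  constant \<open>1 / c\<close>, which has total mass 1.\<close>

lemma hoelder_const:
  assumes "1 \<le> p" and [measurable]: "f \<in> borel_measurable M"
    and "0 < emeasure M (space M)" "emeasure M (space M) < top"
  shows "ennpowr (\<integral>\<^sup>+x. f x \<partial>M) p \<le> ennpowr (emeasure M (space M)) (p - 1) * (\<integral>\<^sup>+x. ennpowr (f x) p \<partial>M)"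
proof (rule ennpowr_le_if_tangent_le)
  fix m :: real assume m: "0 \<le> m"
  obtain c where c: "emeasure M (space M) = ennreal c" "0 < c"
    using assms by (cases "emeasure M (space M)") auto
  have "ennreal (p * m powr (p - 1)) * (\<integral>\<^sup>+x. f x \<partial>M) = (\<integral>\<^sup>+x. ennreal (p * m powr (p - 1)) * f x \<partial>M)"
    by (simp add: nn_integral_cmult)
  also have "\<dots> \<le> (\<integral>\<^sup>+x. ennpowr (f x) p * ennpowr (ennreal (1 / c)) (1 - p)
      + ennreal ((p - 1) * m powr p) * ennreal (1 / c) \<partial>M)"
    using assms m c by (intro nn_integral_mono ennpowr_ge_tangent) auto
  also have "\<dots> = (\<integral>\<^sup>+x. ennpowr (f x) p \<partial>M) * ennpowr (ennreal (1 / c)) (1 - p) + ennreal ((p - 1) * m powr p)"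
    using c assms m by (simp add: nn_integral_add nn_integral_multc mult.assoc flip: ennreal_mult)
  also have "ennpowr (ennreal (1 / c)) (1 - p) = ennpowr (emeasure M (space M)) (p - 1)"
    using c by (simp add: ennpowr_ennreal powr_divide powr_diff)
  finally show "ennreal (p * m powr (p - 1)) * (\<integral>\<^sup>+x. f x \<partial>M)
      \<le> ennpowr (emeasure M (space M)) (p - 1) * (\<integral>\<^sup>+x. ennpowr (f x) p \<partial>M) + ennreal ((p - 1) * m powr p)"
    by (simp add: mult.commute)
qed fact

text \<open>The weight in the tangent bound is \<open>K y / I\<close>, the norm of the slice at
  \<open>y\<close> divided by the integral of these norms. After Fubini the integrand is the
  \<open>p\<close>-th power of \<open>K y\<close> times the power \<open>1 - p\<close> of
  \<open>K y / I\<close>, that is \<open>K y\<close> times the power \<open>p - 1\<close> of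
  \<open>I\<close>, and it integrates to the \<open>p\<close>-th power of \<open>I\<close>. The
  left-hand side is never divided by, so it may be infinite a priori.\<close>

lemma nn_integral_minkowski:
  assumes "sigma_finite_measure M" "sigma_finite_measure N" "1 \<le> p"
    and [measurable]: "case_prod f \<in> borel_measurable (M \<Otimes>\<^sub>M N)"
  shows "ennpowr (\<integral>\<^sup>+x. ennpowr (\<integral>\<^sup>+y. f x y \<partial>N) p \<partial>M) (1 / p)
    \<le> (\<integral>\<^sup>+y. ennpowr (\<integral>\<^sup>+x. ennpowr (f x y) p \<partial>M) (1 / p) \<partial>N)"
proof -
  interpret M: sigma_finite_measure M by fact
  interpret N: sigma_finite_measure N by fact
  interpret pair_sigma_finite M N ..
  define K where "K y = ennpowr (\<integral>\<^sup>+x. ennpowr (f x y) p \<partial>M) (1 / p)" for y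
  have [measurable]: "K \<in> borel_measurable N"
    unfolding K_def by measurable
  have K: "ennpowr (K y) p = (\<integral>\<^sup>+x. ennpowr (f x y) p \<partial>M)" for y
    using \<open>1 \<le> p\<close> by (simp add: K_def ennpowr_ennpowr)
  define I where "I = (\<integral>\<^sup>+y. K y \<partial>N)"
  have "(\<integral>\<^sup>+x. (\<integral>\<^sup>+y. (if K y = 0 then ennpowr (f x y) p else 0) \<partial>N) \<partial>M)
      = (\<integral>\<^sup>+y. (\<integral>\<^sup>+x. (if K y = 0 then ennpowr (f x y) p else 0) \<partial>M) \<partial>N)"
    by (rule Fubini'[symmetric]) measurable
  also have "\<dots> = (\<integral>\<^sup>+y. 0 \<partial>N)"
  proof (rule nn_integral_cong)
    show "(\<integral>\<^sup>+x. (if K y = 0 then ennpowr (f x y) p else 0) \<partial>M) = 0" for y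
      using K[of y] by (cases "K y = 0") simp_all
  qed
  finally have "AE x in M. (\<integral>\<^sup>+y. (if K y = 0 then ennpowr (f x y) p else 0) \<partial>N) = 0"
    by (subst nn_integral_0_iff_AE[symmetric]) auto
  then have zero: "AE x in M. AE y in N. K y = 0 \<longrightarrow> f x y = 0"
    using AE_space
  proof eventually_elim
    case (elim x)
    note [measurable] = \<open>x \<in> space M\<close>
    have "AE y in N. (if K y = 0 then ennpowr (f x y) p else 0) = 0"
      using elim(1) by (subst nn_integral_0_iff_AE[symmetric]) auto
    then show ?case
      by eventually_elim (auto split: if_splits)
  qed
  show ?thesis
  proof (cases "I = 0 \<or> I = top")
    case True
    then show ?thesis
    proof
      assume "I = 0"
      then have "AE y in N. K y = 0"
        by (simp add: I_def nn_integral_0_iff_AE)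
      with zero have "AE x in M. AE y in N. f x y = 0"
        by (auto elim!: eventually_mono eventually_rev_mp)
      then have "AE x in M. (\<integral>\<^sup>+y. f x y \<partial>N) = 0"
        using AE_space
      proof eventually_elim
        case (elim x)
        then show ?case by (subst nn_integral_0_iff_AE) auto
      qed
      then have "(\<integral>\<^sup>+x. ennpowr (\<integral>\<^sup>+y. f x y \<partial>N) p \<partial>M) = 0"
        by (subst nn_integral_0_iff_AE) auto
      then show ?thesis by simp
    qed (simp add: I_def K_def)
  next
    case False
    then have I: "0 < I" "I < top" "I \<noteq> 0" "I \<noteq> top"
      by (auto simp: less_top zero_less_iff_neq_zero)
    have fin: "AE y in N. K y \<noteq> top"
      using nn_integral_PInf_AE[of K N] I by (simp add: I_def)
    define X where "X x = (\<integral>\<^sup>+y. (if K y = 0 then 0 else ennpowr (f x y) p * ennpowr (K y / I) (1 - p)) \<partial>N)" for x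
    have "AE x in M. ennpowr (\<integral>\<^sup>+y. f x y \<partial>N) p \<le> X x"
      using zero AE_space
    proof eventually_elim
      case (elim x)
      note [measurable] = \<open>x \<in> space M\<close>
      show ?case
      proof (rule ennpowr_le_if_tangent_le)
        fix m :: real assume m: "0 \<le> m"
        have "ennreal (p * m powr (p - 1)) * (\<integral>\<^sup>+y. f x y \<partial>N) = (\<integral>\<^sup>+y. ennreal (p * m powr (p - 1)) * f x y \<partial>N)"
          by (simp add: nn_integral_cmult)
        also have "\<dots> \<le> (\<integral>\<^sup>+y. (if K y = 0 then 0 else ennpowr (f x y) p * ennpowr (K y / I) (1 - p))
            + ennreal ((p - 1) * m powr p) * (K y / I) \<partial>N)"
        proof (rule nn_integral_mono_AE)
          show "AE y in N. ennreal (p * m powr (p - 1)) * f x y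
            \<le> (if K y = 0 then 0 else ennpowr (f x y) p * ennpowr (K y / I) (1 - p))
            + ennreal ((p - 1) * m powr p) * (K y / I)"
            using elim(1) fin
          proof eventually_elim
            case (elim y)
            show ?case
            proof (cases "K y = 0")
              case False
              then obtain i k where "I = ennreal i" "0 < i" "K y = ennreal k" "0 < k"
                using I elim by (cases I; cases "K y") (auto simp: less_le)
              then have "0 < K y / I" "K y / I < top"
                by (simp_all add: divide_ennreal)
              then show ?thesis
                using False ennpowr_ge_tangent[of p m "K y / I" "f x y"] \<open>1 \<le> p\<close> m by simp
            qed (use elim in simp)
          qed
        qed
        also have "\<dots> = X x + ennreal ((p - 1) * m powr p) * (I / I)"
          by (simp add: X_def nn_integral_add nn_integral_cmult nn_integral_divide I_def)
        also have "I / I = 1"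
          using I by (simp add: ennreal_divide_self)
        finally show "ennreal (p * m powr (p - 1)) * (\<integral>\<^sup>+y. f x y \<partial>N) \<le> X x + ennreal ((p - 1) * m powr p)"
          by simp
      qed fact
    qed
    then have "(\<integral>\<^sup>+x. ennpowr (\<integral>\<^sup>+y. f x y \<partial>N) p \<partial>M) \<le> (\<integral>\<^sup>+x. X x \<partial>M)"
      by (rule nn_integral_mono_AE)
    also have "\<dots> = (\<integral>\<^sup>+y. (\<integral>\<^sup>+x. (if K y = 0 then 0 else ennpowr (f x y) p * ennpowr (K y / I) (1 - p)) \<partial>M) \<partial>N)"
      unfolding X_def by (rule Fubini'[symmetric]) measurable
    also have "\<dots> = (\<integral>\<^sup>+y. (if K y = 0 then 0 else ennpowr (K y) p * ennpowr (K y / I) (1 - p)) \<partial>N)"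
    proof (rule nn_integral_cong)
      fix y assume [measurable]: "y \<in> space N"
      show "(\<integral>\<^sup>+x. (if K y = 0 then 0 else ennpowr (f x y) p * ennpowr (K y / I) (1 - p)) \<partial>M)
        = (if K y = 0 then 0 else ennpowr (K y) p * ennpowr (K y / I) (1 - p))"
        by (simp add: nn_integral_multc K)
    qed
    also have "\<dots> = (\<integral>\<^sup>+y. K y * ennpowr I (p - 1) \<partial>N)"
    proof (rule nn_integral_cong_AE)
      show "AE y in N. (if K y = 0 then 0 else ennpowr (K y) p * ennpowr (K y / I) (1 - p)) = K y * ennpowr I (p - 1)"
        using fin
      proof eventually_elim
        case (elim y)
        obtain i k where ik: "I = ennreal i" "0 < i" "K y = ennreal k" "0 \<le> k"
          using I elim by (cases I; cases "K y") (auto simp: less_le)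
        then show ?case
          by (cases "k = 0")
            (auto simp: ennpowr_ennreal divide_ennreal powr_divide powr_diff field_simps simp flip: ennreal_mult)
      qed
    qed
    also have "\<dots> = I * ennpowr I (p - 1)"
      by (simp add: nn_integral_multc I_def)
    also have "\<dots> = ennpowr I p"
      using ennpowr_add[of I 1 "p - 1"] I by simp
    finally show ?thesis
      using ennpowr_le_iff_le_root[of "1 / p"] \<open>1 \<le> p\<close> by (simp add: I_def K_def)
  qed
qed

section \<open>Young's inequality for kernels bounded in both variables\<close>

lemma nn_integral_young_aux:
  assumes "sigma_finite_measure M" "sigma_finite_measure N"
    and "1 \<le> r" "1 \<le> s" "r \<le> p" "s \<le> p" "1 / p + 1 = 1 / s + 1 / r"
    and [measurable]: "case_prod k \<in> borel_measurable (M \<Otimes>\<^sub>M N)" "h \<in> borel_measurable N"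
    and kx: "AE x in M. (\<integral>\<^sup>+y. ennpowr (k x y) s \<partial>N) \<le> 1"
    and ky: "AE y in N. (\<integral>\<^sup>+x. ennpowr (k x y) s \<partial>M) \<le> 1"
    and h: "(\<integral>\<^sup>+y. ennpowr (h y) r \<partial>N) \<le> 1"
  shows "(\<integral>\<^sup>+x. ennpowr (\<integral>\<^sup>+y. k x y * h y \<partial>N) p \<partial>M) \<le> 1"
proof -
  interpret M: sigma_finite_measure M by fact
  interpret N: sigma_finite_measure N by fact
  interpret pair_sigma_finite M N ..
  have "p / s - 1 + (p / r - 1) = p * (1 / s + 1 / r) - 2"
    by (simp add: algebra_simps)
  also have "\<dots> = p * (1 / p + 1) - 2"
    using assms(7) by simp
  also have "\<dots> = p - 1"
    using assms(3,5) by (simp add: distrib_left)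
  finally have p: "p / s - 1 + (p / r - 1) = p - 1" .
  have p': "0 \<le> p / s - 1" "0 \<le> p / r - 1" "1 \<le> p"
    using assms by simp_all
  \<comment> \<open>With the norms normalised, the last two terms of the pointwise bound integrate
    to at most \<open>(p - 1) * m powr p\<close>, because their coefficients add up to it;
    optimising in \<open>m\<close> removes them. The remaining double integral separates by
    Fubini.\<close>
  have "(\<integral>\<^sup>+x. ennpowr (\<integral>\<^sup>+y. k x y * h y \<partial>N) p \<partial>M)
      \<le> (\<integral>\<^sup>+x. (\<integral>\<^sup>+y. ennpowr (k x y) s * ennpowr (h y) r \<partial>N) \<partial>M)"
  proof (rule nn_integral_mono_AE)
    show "AE x in M. ennpowr (\<integral>\<^sup>+y. k x y * h y \<partial>N) p \<le> (\<integral>\<^sup>+y. ennpowr (k x y) s * ennpowr (h y) r \<partial>N)"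
      using kx AE_space
    proof eventually_elim
      case (elim x)
      note [measurable] = \<open>x \<in> space M\<close>
      show ?case
      proof (rule ennpowr_le_if_tangent_le)
        fix m :: real assume m: "0 \<le> m"
        have "ennreal (p * m powr (p - 1)) * (\<integral>\<^sup>+y. k x y * h y \<partial>N)
            = (\<integral>\<^sup>+y. ennreal (p * m powr (p - 1)) * (k x y * h y) \<partial>N)"
          by (simp add: nn_integral_cmult)
        also have "\<dots> \<le> (\<integral>\<^sup>+y. ennpowr (k x y) s * ennpowr (h y) r
            + (ennreal (m powr p * (p / s - 1)) * ennpowr (k x y) s
              + ennreal (m powr p * (p / r - 1)) * ennpowr (h y) r) \<partial>N)"
          using assms m by (intro nn_integral_mono ennpowr_ge_young_tangent) auto
        also have "\<dots> = (\<integral>\<^sup>+y. ennpowr (k x y) s * ennpowr (h y) r \<partial>N)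
            + (ennreal (m powr p * (p / s - 1)) * (\<integral>\<^sup>+y. ennpowr (k x y) s \<partial>N)
              + ennreal (m powr p * (p / r - 1)) * (\<integral>\<^sup>+y. ennpowr (h y) r \<partial>N))"
          by (simp add: nn_integral_add nn_integral_cmult)
        also have "\<dots> \<le> (\<integral>\<^sup>+y. ennpowr (k x y) s * ennpowr (h y) r \<partial>N)
            + (ennreal (m powr p * (p / s - 1)) * 1 + ennreal (m powr p * (p / r - 1)) * 1)"
          using elim(1) h by (intro add_mono mult_left_mono order_refl) auto
        also have "ennreal (m powr p * (p / s - 1)) * 1 + ennreal (m powr p * (p / r - 1)) * 1
            = ennreal (m powr p * (p / s - 1) + m powr p * (p / r - 1))"
          using p' by simp
        also have "m powr p * (p / s - 1) + m powr p * (p / r - 1) = m powr p * (p - 1)"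
          by (simp only: p flip: distrib_left)
        finally show "ennreal (p * m powr (p - 1)) * (\<integral>\<^sup>+y. k x y * h y \<partial>N)
            \<le> (\<integral>\<^sup>+y. ennpowr (k x y) s * ennpowr (h y) r \<partial>N) + ennreal ((p - 1) * m powr p)"
          by (simp add: mult.commute)
      qed (use p' in simp)
    qed
  qed
  also have "\<dots> = (\<integral>\<^sup>+y. (\<integral>\<^sup>+x. ennpowr (k x y) s * ennpowr (h y) r \<partial>M) \<partial>N)"
    by (rule Fubini'[symmetric]) measurable
  also have "\<dots> = (\<integral>\<^sup>+y. (\<integral>\<^sup>+x. ennpowr (k x y) s \<partial>M) * ennpowr (h y) r \<partial>N)"
    by (intro nn_integral_cong nn_integral_multc) measurable
  also have "\<dots> \<le> (\<integral>\<^sup>+y. 1 * ennpowr (h y) r \<partial>N)"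
  proof (rule nn_integral_mono_AE)
    show "AE y in N. (\<integral>\<^sup>+x. ennpowr (k x y) s \<partial>M) * ennpowr (h y) r \<le> 1 * ennpowr (h y) r"
      using ky by eventually_elim (rule mult_right_mono, simp_all)
  qed
  also have "\<dots> \<le> 1"
    using h by simp
  finally show ?thesis .
qed

text \<open>Reduction to the normalised case by scaling \<open>k\<close> and \<open>h\<close>
  separately. The uniform bounds \<open>kx\<close> and \<open>ky\<close> stand for the invariance of
  a group measure, under which both integrals of a convolution kernel equal the integral of a single
  function.\<close>

lemma nn_integral_young:
  assumes "sigma_finite_measure M" "sigma_finite_measure N"
    and "1 \<le> r" "1 \<le> s" "r \<le> p" "s \<le> p" "1 / p + 1 = 1 / s + 1 / r"
    and [measurable]: "case_prod k \<in> borel_measurable (M \<Otimes>\<^sub>M N)" "h \<in> borel_measurable N"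
    and kx: "AE x in M. (\<integral>\<^sup>+y. ennpowr (k x y) s \<partial>N) \<le> S"
    and ky: "AE y in N. (\<integral>\<^sup>+x. ennpowr (k x y) s \<partial>M) \<le> S"
  shows "ennpowr (\<integral>\<^sup>+x. ennpowr (\<integral>\<^sup>+y. k x y * h y \<partial>N) p \<partial>M) (1 / p)
    \<le> ennpowr S (1 / s) * ennpowr (\<integral>\<^sup>+y. ennpowr (h y) r \<partial>N) (1 / r)"
proof -
  interpret M: sigma_finite_measure M by fact
  interpret N: sigma_finite_measure N by fact
  interpret pair_sigma_finite M N ..
  define P where "P = (\<integral>\<^sup>+y. ennpowr (h y) r \<partial>N)"
  \<comment> \<open>Because \<open>0 * top = 0\<close>, the right-hand side vanishes as soon as
    \<open>S\<close> or \<open>P\<close> does, even if the other is infinite. In these cases the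
    left-hand side must be shown to vanish as well.\<close>
  consider "S = 0" | "P = 0" | "S \<noteq> 0" "P \<noteq> 0" "S = top \<or> P = top"
    | "S \<noteq> 0" "P \<noteq> 0" "S \<noteq> top" "P \<noteq> top" by blast
  then show ?thesis
  proof cases
    case 1
    have "AE x in M. ennpowr (\<integral>\<^sup>+y. k x y * h y \<partial>N) p = 0"
      using kx AE_space
    proof eventually_elim
      case (elim x)
      note [measurable] = \<open>x \<in> space M\<close>
      have "AE y in N. k x y = 0"
        using elim(1) 1 by (simp add: nn_integral_0_iff_AE)
      then show ?case by (subst ennpowr_eq_zero_iff, subst nn_integral_0_iff_AE) auto
    qed
    then show ?thesis
      by (subst (asm) nn_integral_0_iff_AE[symmetric]) simp_all
  next
    case 2
    then have "AE y in N. h y = 0"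
      by (simp add: P_def nn_integral_0_iff_AE)
    then have "(\<integral>\<^sup>+y. k x y * h y \<partial>N) = 0" if x[measurable]: "x \<in> space M" for x
      by (subst nn_integral_0_iff_AE) auto
    then have "(\<integral>\<^sup>+x. ennpowr (\<integral>\<^sup>+y. k x y * h y \<partial>N) p \<partial>M) = (\<integral>\<^sup>+x. 0 \<partial>M)"
      by (intro nn_integral_cong) simp
    then show ?thesis by simp
  next
    case 3
    then have "ennpowr S (1 / s) * ennpowr P (1 / r) = top"
      by (auto simp: ennreal_mult_eq_top_iff)
    then show ?thesis by (simp add: P_def)
  next
    case 4
    define a where "a = ennpowr S (- 1 / s)"
    define b where "b = ennpowr P (- 1 / r)"
    have cancel: "ennpowr x t * ennpowr x (- t) = 1" if "x \<noteq> 0" "x \<noteq> top" for x t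
      using ennpowr_add[OF that, of t "- t"] that by (cases x) (simp_all add: ennpowr_ennreal)
    have a: "ennpowr a s * S = 1" "ennpowr S (1 / s) * a = 1"
      using cancel[of S "-1"] cancel[of S "1 / s"] 4 assms by (simp_all add: a_def ennpowr_ennpowr)
    have b: "ennpowr b r * P = 1" "ennpowr P (1 / r) * b = 1"
      using cancel[of P "-1"] cancel[of P "1 / r"] 4 assms by (simp_all add: b_def ennpowr_ennpowr)
    have "(\<integral>\<^sup>+x. ennpowr (\<integral>\<^sup>+y. (a * k x y) * (b * h y) \<partial>N) p \<partial>M) \<le> 1"
    proof (rule nn_integral_young_aux[OF assms(1-7)])
      show "AE x in M. (\<integral>\<^sup>+y. ennpowr (a * k x y) s \<partial>N) \<le> 1"
        using kx AE_space
      proof eventually_elim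
        case (elim x)
        note [measurable] = \<open>x \<in> space M\<close>
        show ?case
          using mult_left_mono[OF elim(1), of "ennpowr a s"] a by (simp add: ennpowr_mult nn_integral_cmult)
      qed
      show "AE y in N. (\<integral>\<^sup>+x. ennpowr (a * k x y) s \<partial>M) \<le> 1"
        using ky AE_space
      proof eventually_elim
        case (elim y)
        note [measurable] = \<open>y \<in> space N\<close>
        show ?case
          using mult_left_mono[OF elim(1), of "ennpowr a s"] a by (simp add: ennpowr_mult nn_integral_cmult)
      qed
      show "(\<integral>\<^sup>+y. ennpowr (b * h y) r \<partial>N) \<le> 1"
        using b by (simp add: ennpowr_mult nn_integral_cmult P_def)
    qed measurable
    also have "(\<integral>\<^sup>+x. ennpowr (\<integral>\<^sup>+y. (a * k x y) * (b * h y) \<partial>N) p \<partial>M)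
        = (\<integral>\<^sup>+x. ennpowr (a * b) p * ennpowr (\<integral>\<^sup>+y. k x y * h y \<partial>N) p \<partial>M)"
    proof (rule nn_integral_cong)
      fix x assume [measurable]: "x \<in> space M"
      have "(\<integral>\<^sup>+y. (a * k x y) * (b * h y) \<partial>N) = a * b * (\<integral>\<^sup>+y. k x y * h y \<partial>N)"
        by (subst nn_integral_cmult[symmetric]) (auto simp: mult_ac)
      then show "ennpowr (\<integral>\<^sup>+y. (a * k x y) * (b * h y) \<partial>N) p = ennpowr (a * b) p * ennpowr (\<integral>\<^sup>+y. k x y * h y \<partial>N) p"
        by (simp add: ennpowr_mult)
    qed
    also have "\<dots> = ennpowr (a * b) p * (\<integral>\<^sup>+x. ennpowr (\<integral>\<^sup>+y. k x y * h y \<partial>N) p \<partial>M)"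
      by (rule nn_integral_cmult) measurable
    finally have "ennpowr (ennpowr (a * b) p * (\<integral>\<^sup>+x. ennpowr (\<integral>\<^sup>+y. k x y * h y \<partial>N) p \<partial>M)) (1 / p) \<le> ennpowr 1 (1 / p)"
      using assms by (intro ennpowr_mono) auto
    moreover have "ennpowr 1 (1 / p) = 1"
      using ennpowr_ennreal[of 1] by simp
    ultimately have "a * b * ennpowr (\<integral>\<^sup>+x. ennpowr (\<integral>\<^sup>+y. k x y * h y \<partial>N) p \<partial>M) (1 / p) \<le> 1"
      using assms by (simp add: ennpowr_mult ennpowr_ennpowr)
    then have "ennpowr S (1 / s) * ennpowr P (1 / r) * (a * b * ennpowr (\<integral>\<^sup>+x. ennpowr (\<integral>\<^sup>+y. k x y * h y \<partial>N) p \<partial>M) (1 / p))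
      \<le> ennpowr S (1 / s) * ennpowr P (1 / r) * 1"
      by (rule mult_left_mono) simp
    also have "ennpowr S (1 / s) * ennpowr P (1 / r) * (a * b * ennpowr (\<integral>\<^sup>+x. ennpowr (\<integral>\<^sup>+y. k x y * h y \<partial>N) p \<partial>M) (1 / p))
      = (ennpowr S (1 / s) * a) * (ennpowr P (1 / r) * b) * ennpowr (\<integral>\<^sup>+x. ennpowr (\<integral>\<^sup>+y. k x y * h y \<partial>N) p \<partial>M) (1 / p)"
      by (simp add: mult_ac)
    finally show ?thesis
      by (simp add: a b flip: P_def)
  qed
qed

section \<open>The Haar measure of the multiplicative group\<close>

text \<open>Carried by the whole line, with no mass outside the positive half-line, so that
  measurability remains plain Borel measurability; positivity of the variable is recovered almost
  everywhere.\<close>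

definition mult_haar :: "real measure" where
  "mult_haar = density lborel (\<lambda>r. ennreal (indicator {0<..} r / r))"

lemma sets_mult_haar [simp, measurable_cong]: "sets mult_haar = sets borel"
  by (simp add: mult_haar_def)

lemma space_mult_haar [simp]: "space mult_haar = UNIV"
  by (simp add: mult_haar_def)

lemma sigma_finite_mult_haar: "sigma_finite_measure mult_haar"
  unfolding mult_haar_def by (subst sigma_finite_measure.sigma_finite_iff_density_finite[OF sigma_finite_lborel]) auto

lemma AE_mult_haar_iff: "(AE r in mult_haar. P r) \<longleftrightarrow> (AE r in lborel. 0 < r \<longrightarrow> P r)"
  unfolding mult_haar_def
  by (subst AE_density) (auto simp: indicator_def zero_less_divide_iff intro!: AE_cong)

lemma AE_mult_haar_pos: "AE r in mult_haar. 0 < r"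
  by (simp add: AE_mult_haar_iff)

lemma nn_integral_mult_haar:
  assumes [measurable]: "f \<in> borel_measurable borel"
  shows "(\<integral>\<^sup>+r. f r \<partial>mult_haar) = (\<integral>\<^sup>+r. ennreal (indicator {0<..} r / r) * f r \<partial>lborel)"
  unfolding mult_haar_def by (rule nn_integral_density) measurable

lemma nn_integral_mult_haar_scale:
  assumes [measurable]: "f \<in> borel_measurable borel" and "0 < c"
  shows "(\<integral>\<^sup>+r. f (c * r) \<partial>mult_haar) = (\<integral>\<^sup>+r. f r \<partial>mult_haar)"
proof -
  have "(\<integral>\<^sup>+r. f r \<partial>mult_haar) = ennreal \<bar>c\<bar> * (\<integral>\<^sup>+r. ennreal (indicator {0<..} (c * r) / (c * r)) * f (c * r) \<partial>lborel)"
    using \<open>0 < c\<close> nn_integral_real_affine[of "\<lambda>r. ennreal (indicator {0<..} r / r) * f r" c 0]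
    by (simp add: nn_integral_mult_haar)
  also have "\<dots> = (\<integral>\<^sup>+r. ennreal \<bar>c\<bar> * (ennreal (indicator {0<..} (c * r) / (c * r)) * f (c * r)) \<partial>lborel)"
    by (rule nn_integral_cmult[symmetric]) measurable
  also have "\<dots> = (\<integral>\<^sup>+r. ennreal (indicator {0<..} r / r) * f (c * r) \<partial>lborel)"
    using \<open>0 < c\<close>
    by (intro nn_integral_cong)
      (auto simp: mult.assoc[symmetric] indicator_def zero_less_mult_iff simp flip: ennreal_mult)
  also have "\<dots> = (\<integral>\<^sup>+r. f (c * r) \<partial>mult_haar)"
    by (simp add: nn_integral_mult_haar)
  finally show ?thesis by simp
qed

text \<open>
  Unimodularity, without a change of variables: for any \<open>u\<close>, two translations turn
  \<open>\<integral>u \<cdot> \<integral>f\<close> into \<open>\<integral>u \<cdot> \<integral>f(1/r)\<close>, and there is a \<open>u\<close> with \<open>0 < \<integral>u < \<infinity>\<close>.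
\<close>

lemma nn_integral_mult_haar_inverse:
  assumes [measurable]: "f \<in> borel_measurable borel"
  shows "(\<integral>\<^sup>+r. f (1 / r) \<partial>mult_haar) = (\<integral>\<^sup>+r. f r \<partial>mult_haar)"
proof -
  interpret H: sigma_finite_measure mult_haar by (rule sigma_finite_mult_haar)
  interpret pair_sigma_finite mult_haar mult_haar ..
  define u :: "real \<Rightarrow> ennreal" where "u = indicator {1..2}"
  have [measurable]: "u \<in> borel_measurable borel"
    unfolding u_def by measurable
  define I where "I = (\<integral>\<^sup>+r. u r \<partial>mult_haar)"
  have I_eq: "I = (\<integral>\<^sup>+r. ennreal (indicator {0<..} r / r) * u r \<partial>lborel)"
    by (simp add: I_def nn_integral_mult_haar)
  have "I \<le> (\<integral>\<^sup>+r. indicator {1..2::real} r \<partial>lborel)"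
    unfolding I_eq u_def
    by (intro nn_integral_mono) (auto simp: indicator_def)
  then have "I \<noteq> top"
    by (auto simp: top_unique)
  \<comment> \<open>The least value of \<open>1 / r\<close> on the support of \<open>u\<close>; it
    keeps \<open>I\<close> away from 0.\<close>
  define c :: real where "c = 1 / 2"
  have c: "0 < c" "\<And>r. 1 \<le> r \<Longrightarrow> r \<le> 2 \<Longrightarrow> c \<le> 1 / r"
    by (auto simp: c_def field_simps)
  have "(\<integral>\<^sup>+r. ennreal c * indicator {1..2::real} r \<partial>lborel) \<le> I"
    unfolding I_eq u_def
    using c by (intro nn_integral_mono) (auto simp: indicator_def intro!: ennreal_leI)
  then have "I \<noteq> 0"
    using c by (auto simp: nn_integral_cmult simp flip: ennreal_mult)
  have "I * (\<integral>\<^sup>+r. f r \<partial>mult_haar) = (\<integral>\<^sup>+r. (\<integral>\<^sup>+t. u t * f r \<partial>mult_haar) \<partial>mult_haar)"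
    by (simp add: nn_integral_multc nn_integral_cmult I_def)
  also have "\<dots> = (\<integral>\<^sup>+r. (\<integral>\<^sup>+t. u (r * t) * f r \<partial>mult_haar) \<partial>mult_haar)"
  proof (rule nn_integral_cong_AE)
    show "AE r in mult_haar. (\<integral>\<^sup>+t. u t * f r \<partial>mult_haar) = (\<integral>\<^sup>+t. u (r * t) * f r \<partial>mult_haar)"
      using AE_mult_haar_pos
    proof eventually_elim
      case (elim r)
      then show ?case by (subst nn_integral_mult_haar_scale[where f = "\<lambda>t. u t * f r"]) auto
    qed
  qed
  also have "\<dots> = (\<integral>\<^sup>+t. (\<integral>\<^sup>+r. u (r * t) * f r \<partial>mult_haar) \<partial>mult_haar)"
    by (rule Fubini') measurable
  also have "\<dots> = (\<integral>\<^sup>+t. (\<integral>\<^sup>+r. u r * f (r / t) \<partial>mult_haar) \<partial>mult_haar)"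
  proof (rule nn_integral_cong_AE)
    show "AE t in mult_haar. (\<integral>\<^sup>+r. u (r * t) * f r \<partial>mult_haar) = (\<integral>\<^sup>+r. u r * f (r / t) \<partial>mult_haar)"
      using AE_mult_haar_pos
    proof eventually_elim
      case (elim t)
      then show ?case
        using nn_integral_mult_haar_scale[of "\<lambda>r. u r * f (r / t)" t] by (simp add: mult.commute)
    qed
  qed
  also have "\<dots> = (\<integral>\<^sup>+r. (\<integral>\<^sup>+t. u r * f (r / t) \<partial>mult_haar) \<partial>mult_haar)"
    by (rule Fubini') measurable
  also have "\<dots> = (\<integral>\<^sup>+r. u r * (\<integral>\<^sup>+t. f (1 / t) \<partial>mult_haar) \<partial>mult_haar)"
  proof (rule nn_integral_cong_AE)
    show "AE r in mult_haar. (\<integral>\<^sup>+t. u r * f (r / t) \<partial>mult_haar) = u r * (\<integral>\<^sup>+t. f (1 / t) \<partial>mult_haar)"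
      using AE_mult_haar_pos
    proof eventually_elim
      case (elim r)
      then show ?case
        using nn_integral_mult_haar_scale[of "\<lambda>t. f (r / t)" r] by (simp add: nn_integral_cmult)
    qed
  qed
  also have "\<dots> = I * (\<integral>\<^sup>+t. f (1 / t) \<partial>mult_haar)"
    by (simp add: nn_integral_multc I_def)
  finally show ?thesis
    using \<open>I \<noteq> 0\<close> \<open>I \<noteq> top\<close> by (simp add: ennreal_mult_cancel_left)
qed

lemma nn_integral_mult_haar_reflect:
  assumes [measurable]: "f \<in> borel_measurable borel" and "0 < c"
  shows "(\<integral>\<^sup>+r. f (c / r) \<partial>mult_haar) = (\<integral>\<^sup>+r. f r \<partial>mult_haar)"
  using nn_integral_mult_haar_inverse[of "\<lambda>r. f (c * r)"] nn_integral_mult_haar_scale[OF assms] by simp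

text \<open>Supplies the factor \<open>1 / n\<close> that cancels the dimension in the cone measure
  when polar coordinates are derived.\<close>

lemma nn_integral_mult_haar_tail:
  assumes "0 < c" "0 < n"
  shows "(\<integral>\<^sup>+r. indicator {c<..} r * ennreal (1 / r ^ n) \<partial>mult_haar) = ennreal (1 / (real n * c ^ n))"
proof -
  have "(\<integral>\<^sup>+r. indicator {c<..} r * ennreal (1 / r ^ n) \<partial>mult_haar)
      = (\<integral>\<^sup>+r. ennreal (indicator {0<..} r / r) * (indicator {c<..} r * ennreal (1 / r ^ n)) \<partial>lborel)"
    by (rule nn_integral_mult_haar) measurable
  \<comment> \<open>The endpoint \<open>c\<close> is a null set; adding it gives the closed
    half-line to which the fundamental theorem of calculus applies.\<close>
  also have "\<dots> = (\<integral>\<^sup>+r. ennreal (1 / r ^ Suc n) * indicator {c..} r \<partial>lborel)"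
  proof (rule nn_integral_cong_AE)
    show "AE r in lborel. ennreal (indicator {0<..} r / r) * (indicator {c<..} r * ennreal (1 / r ^ n))
        = ennreal (1 / r ^ Suc n) * indicator {c..} r"
      using AE_lborel_singleton[of c]
    proof eventually_elim
      case (elim r)
      then show ?case
        using \<open>0 < c\<close> by (auto simp: indicator_def simp flip: ennreal_mult)
    qed
  qed
  also have "\<dots> = ennreal (0 - (- (1 / (real n * c ^ n))))"
  proof (rule nn_integral_FTC_atLeast)
    show "((\<lambda>r. - (1 / (real n * r ^ n))) has_real_derivative 1 / x ^ Suc n) (at x)" if "c \<le> x" for x
    proof -
      have "((\<lambda>r. - (1 / (real n * r ^ n))) has_real_derivative
          (real n * (real n * x ^ (n - 1))) / (real n * x ^ n * (real n * x ^ n))) (at x)"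
        using that assms by (auto intro!: derivative_eq_intros simp: field_simps)
      also have "(real n * (real n * x ^ (n - 1))) / (real n * x ^ n * (real n * x ^ n)) = 1 / x ^ Suc n"
      proof -
        have "x ^ n = x * x ^ (n - 1)"
          using \<open>0 < n\<close> by (simp add: power_eq_if)
        then show ?thesis
          using that assms by simp
      qed
      finally show ?thesis .
    qed
    have "filterlim (\<lambda>r::real. r ^ n) at_top at_top"
      using assms by (intro filterlim_pow_at_top filterlim_ident) auto
    then have "((\<lambda>r::real. inverse (r ^ n)) \<longlongrightarrow> 0) at_top"
      by (rule tendsto_inverse_0_at_top)
    then have "((\<lambda>r::real. - (inverse (real n) * inverse (r ^ n))) \<longlongrightarrow> - (inverse (real n) * 0)) at_top"
      by (intro tendsto_intros)
    then show "((\<lambda>r::real. - (1 / (real n * r ^ n))) \<longlongrightarrow> 0) at_top"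
      by (simp add: field_simps)
    show "0 \<le> 1 / x ^ Suc n" if "c \<le> x" for x
      using that assms by simp
  qed measurable
  finally show ?thesis by simp
qed

section \<open>Polar coordinates\<close>

lemma finite_measure_sphere_measure: "finite_measure (sphere_measure :: 'a::euclidean_space measure)"
proof
  have "emeasure (sphere_measure :: 'a measure) (sphere 0 1) \<le> of_nat DIM('a) * emeasure lborel (ball 0 1 :: 'a set)"
    by (subst emeasure_sphere_measure) (auto intro!: mult_left_mono emeasure_mono)
  also have "\<dots> < top"
    using emeasure_lborel_ball_finite[of "0::'a" 1] by (simp add: ennreal_mult_less_top of_nat_less_top)
  finally show "emeasure (sphere_measure :: 'a measure) (space sphere_measure) \<noteq> \<infinity>"
    by (simp add: space_sphere_measure)
qed

lemma emeasure_sphere_measure_pos: "0 < emeasure (sphere_measure :: 'a::euclidean_space measure) (sphere 0 1)"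
proof -
  have "{x::'a. 0 < norm x \<and> norm x < 1 \<and> sgn x \<in> sphere 0 1} = ball 0 1 - {0}"
    by (auto simp: norm_sgn)
  moreover have "emeasure lborel (ball 0 1 - {0} :: 'a set) = emeasure lborel (ball 0 1 :: 'a set)"
    by (rule emeasure_Diff_null_set) auto
  moreover have "emeasure lborel (ball 0 1 :: 'a set) > 0"
    by (simp add: emeasure_ball)
  ultimately show ?thesis
    by (simp add: emeasure_sphere_measure ennreal_zero_less_mult_iff)
qed

lemma measurable_ident_sphere [measurable]: "(\<lambda>x. x) \<in> sphere_measure \<rightarrow>\<^sub>M borel"
  by (subst measurable_cong_sets[OF sets_sphere_measure refl]) (rule measurable_restrict_space1, simp)

lemma measurable_snd_sphere [measurable]: "snd \<in> M \<Otimes>\<^sub>M sphere_measure \<rightarrow>\<^sub>M borel"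
  using measurable_compose[OF measurable_snd measurable_ident_sphere] by simp

lemma measurable_sgn_euclidean [measurable]: "(sgn :: 'a::euclidean_space \<Rightarrow> 'a) \<in> borel \<rightarrow>\<^sub>M borel"
  unfolding sgn_div_norm[abs_def] by measurable

lemma nn_integral_sphere_measure:
  fixes h :: "'a::euclidean_space \<Rightarrow> ennreal"
  assumes [measurable]: "h \<in> borel_measurable borel"
  shows "(\<integral>\<^sup>+\<theta>. h \<theta> \<partial>sphere_measure)
    = of_nat DIM('a) * (\<integral>\<^sup>+x. h (sgn x) * indicator (ball 0 1 - {0}) x \<partial>lborel)"
proof -
  let ?R = "restrict_space lborel (ball 0 1 - {0} :: 'a set)"
  let ?S = "restrict_space borel (sphere 0 1 :: 'a set)"
  have [measurable]: "h \<in> borel_measurable ?S"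
    by (rule measurable_restrict_space1) simp
  have "sgn \<in> borel_measurable ?R"
    by (rule measurable_restrict_space1) simp
  then have sgn: "sgn \<in> ?R \<rightarrow>\<^sub>M ?S"
    by (intro measurable_restrict_space2) (auto simp: space_restrict_space norm_sgn)
  have "(\<integral>\<^sup>+\<theta>. h \<theta> \<partial>sphere_measure) = of_nat DIM('a) * (\<integral>\<^sup>+\<theta>. h \<theta> \<partial>distr ?R ?S sgn)"
    unfolding sphere_measure_def by (rule nn_integral_scale_measure) simp
  also have "(\<integral>\<^sup>+\<theta>. h \<theta> \<partial>distr ?R ?S sgn) = (\<integral>\<^sup>+x. h (sgn x) \<partial>?R)"
    by (rule nn_integral_distr[OF sgn]) simp
  also have "\<dots> = (\<integral>\<^sup>+x. h (sgn x) * indicator (ball 0 1 - {0}) x \<partial>lborel)"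
    by (rule nn_integral_restrict_space) simp
  finally show ?thesis .
qed

lemma nn_integral_lborel_scaleR:
  fixes f :: "'a::euclidean_space \<Rightarrow> ennreal"
  assumes [measurable]: "f \<in> borel_measurable borel" and "0 < r"
  shows "(\<integral>\<^sup>+x. f (r *\<^sub>R x) \<partial>lborel) = ennreal (1 / r ^ DIM('a)) * (\<integral>\<^sup>+x. f x \<partial>lborel)"
proof -
  have "(\<integral>\<^sup>+x. f x \<partial>lborel) = ennreal (r ^ DIM('a)) * (\<integral>\<^sup>+x. f (r *\<^sub>R x) \<partial>lborel)"
    using \<open>0 < r\<close>
    by (subst lborel_affine[of r 0]) (simp_all add: nn_integral_density nn_integral_distr nn_integral_cmult)
  then show ?thesis
    using \<open>0 < r\<close> by (simp add: mult.assoc[symmetric] flip: ennreal_mult)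
qed

lemma pair_sigma_finite_mult_haar_sphere:
  "pair_sigma_finite mult_haar (sphere_measure :: 'a::euclidean_space measure)"
  using finite_measure_sphere_measure[where 'a = 'a]
  by (simp add: pair_sigma_finite_def sigma_finite_mult_haar finite_measure_def)

text \<open>Polar coordinates from scaling invariance and Fubini alone. The cone measure turns the
  spherical integral into one over the unit ball with argument \<open>r *\<^sub>R sgn x\<close>.
  Replacing \<open>r\<close> by \<open>norm x * r\<close> leaves dr/r unchanged and removes
  \<open>sgn\<close>, so that \<open>y = r *\<^sub>R x\<close> is a dilation of the whole space. For
  fixed \<open>y\<close> there remains an integral of \<open>1 / r ^ n\<close> over
  \<open>r > norm y\<close>, whose value cancels both \<open>n\<close> and
  \<open>norm y ^ n\<close>.\<close>

lemma nn_integral_polar: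
  fixes f :: "'a::euclidean_space \<Rightarrow> ennreal"
  assumes [measurable]: "f \<in> borel_measurable borel"
  shows "(\<integral>\<^sup>+x. f x \<partial>lborel)
    = (\<integral>\<^sup>+r. (\<integral>\<^sup>+\<theta>. f (r *\<^sub>R \<theta>) * ennreal (r ^ DIM('a)) \<partial>sphere_measure) \<partial>mult_haar)"
proof -
  define n where "n = DIM('a)"
  define B where "B = (ball 0 1 - {0} :: 'a set)"
  have [measurable]: "B \<in> sets borel"
    by (simp add: B_def)
  interpret H: sigma_finite_measure mult_haar by (rule sigma_finite_mult_haar)
  interpret pair_sigma_finite mult_haar "lborel :: 'a measure" ..
  have norm_sgn_eq: "norm x *\<^sub>R sgn x = x" for x :: 'a
    by (cases "x = 0") (simp_all add: sgn_div_norm)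
  define g :: "real \<Rightarrow> 'a \<Rightarrow> ennreal" where
    "g r y = f y * ennreal (norm y ^ n) * indicator {y. 0 < norm y \<and> norm y < r} y" for r y
  have g_meas[measurable]: "case_prod g \<in> borel_measurable (borel \<Otimes>\<^sub>M borel)"
    unfolding g_def split_beta' indicator_def by measurable
  have "(\<integral>\<^sup>+r. (\<integral>\<^sup>+\<theta>. f (r *\<^sub>R \<theta>) * ennreal (r ^ n) \<partial>sphere_measure) \<partial>mult_haar)
      = (\<integral>\<^sup>+r. of_nat n * (\<integral>\<^sup>+x. f (r *\<^sub>R sgn x) * ennreal (r ^ n) * indicator B x \<partial>lborel) \<partial>mult_haar)"
    by (simp add: nn_integral_sphere_measure n_def B_def)
  also have "\<dots> = of_nat n * (\<integral>\<^sup>+r. (\<integral>\<^sup>+x. f (r *\<^sub>R sgn x) * ennreal (r ^ n) * indicator B x \<partial>lborel) \<partial>mult_haar)"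
    by (rule nn_integral_cmult) measurable
  also have "(\<integral>\<^sup>+r. (\<integral>\<^sup>+x. f (r *\<^sub>R sgn x) * ennreal (r ^ n) * indicator B x \<partial>lborel) \<partial>mult_haar)
      = (\<integral>\<^sup>+x. (\<integral>\<^sup>+r. f (r *\<^sub>R sgn x) * ennreal (r ^ n) * indicator B x \<partial>mult_haar) \<partial>lborel)"
    by (rule Fubini'[symmetric]) measurable
  also have "\<dots> = (\<integral>\<^sup>+x. (\<integral>\<^sup>+r. f (r *\<^sub>R x) * ennreal ((norm x * r) ^ n) * indicator B x \<partial>mult_haar) \<partial>lborel)"
  proof (rule nn_integral_cong)
    fix x :: 'a
    show "(\<integral>\<^sup>+r. f (r *\<^sub>R sgn x) * ennreal (r ^ n) * indicator B x \<partial>mult_haar)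
      = (\<integral>\<^sup>+r. f (r *\<^sub>R x) * ennreal ((norm x * r) ^ n) * indicator B x \<partial>mult_haar)"
    proof (cases "x = 0")
      case False
      have "(norm x * r) *\<^sub>R sgn x = r *\<^sub>R x" for r
        by (metis norm_sgn_eq mult.commute scaleR_scaleR)
      then show ?thesis
        using nn_integral_mult_haar_scale[of "\<lambda>r. f (r *\<^sub>R sgn x) * ennreal (r ^ n) * indicator B x" "norm x"] False
        by simp
    qed (simp add: B_def)
  qed
  also have "\<dots> = (\<integral>\<^sup>+r. (\<integral>\<^sup>+x. f (r *\<^sub>R x) * ennreal ((norm x * r) ^ n) * indicator B x \<partial>lborel) \<partial>mult_haar)"
    by (rule Fubini') measurable
  also have "\<dots> = (\<integral>\<^sup>+r. (\<integral>\<^sup>+y. g r y * ennreal (1 / r ^ n) \<partial>lborel) \<partial>mult_haar)"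
  proof (rule nn_integral_cong_AE)
    show "AE r in mult_haar. (\<integral>\<^sup>+x. f (r *\<^sub>R x) * ennreal ((norm x * r) ^ n) * indicator B x \<partial>lborel)
      = (\<integral>\<^sup>+y. g r y * ennreal (1 / r ^ n) \<partial>lborel)"
      using AE_mult_haar_pos
    proof eventually_elim
      case (elim r)
      have [measurable]: "g r \<in> borel_measurable borel"
        unfolding g_def indicator_def by measurable
      have "(\<integral>\<^sup>+x. f (r *\<^sub>R x) * ennreal ((norm x * r) ^ n) * indicator B x \<partial>lborel) = (\<integral>\<^sup>+x. g r (r *\<^sub>R x) \<partial>lborel)"
        using elim by (intro nn_integral_cong) (auto simp: g_def B_def indicator_def mult.commute)
      also have "\<dots> = ennreal (1 / r ^ n) * (\<integral>\<^sup>+x. g r x \<partial>lborel)"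
        unfolding n_def using elim by (intro nn_integral_lborel_scaleR) auto
      finally show ?case
        by (simp add: nn_integral_multc mult.commute)
    qed
  qed
  also have "\<dots> = (\<integral>\<^sup>+y. (\<integral>\<^sup>+r. g r y * ennreal (1 / r ^ n) \<partial>mult_haar) \<partial>lborel)"
    by (rule Fubini'[symmetric]) measurable
  also have "of_nat n * \<dots> = (\<integral>\<^sup>+y. of_nat n * (\<integral>\<^sup>+r. g r y * ennreal (1 / r ^ n) \<partial>mult_haar) \<partial>lborel)"
    by (rule nn_integral_cmult[symmetric]) measurable
  also have "\<dots> = (\<integral>\<^sup>+y. f y \<partial>lborel)"
  proof (rule nn_integral_cong_AE)
    show "AE y in lborel. of_nat n * (\<integral>\<^sup>+r. g r y * ennreal (1 / r ^ n) \<partial>mult_haar) = f y"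
      using AE_lborel_singleton[of 0]
    proof eventually_elim
      case (elim y)
      then have y: "0 < norm y" "0 < n"
        by (simp_all add: n_def)
      have "(\<integral>\<^sup>+r. g r y * ennreal (1 / r ^ n) \<partial>mult_haar)
          = (\<integral>\<^sup>+r. f y * ennreal (norm y ^ n) * (indicator {norm y<..} r * ennreal (1 / r ^ n)) \<partial>mult_haar)"
        using y by (intro nn_integral_cong) (auto simp: g_def indicator_def)
      also have "\<dots> = f y * ennreal (norm y ^ n) * ennreal (1 / (real n * norm y ^ n))"
        using y by (subst nn_integral_cmult)
          (simp_all add: nn_integral_mult_haar_tail measurable_cong_sets[OF sets_mult_haar refl])
      also have "of_nat n * \<dots> = f y * ennreal (real n * norm y ^ n * (1 / (real n * norm y ^ n)))"
        using y by (simp add: ennreal_of_nat_eq_real_of_nat ennreal_mult mult_ac del: times_divide_eq_right)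
      also have "\<dots> = f y"
        using y by simp
      finally show ?case .
    qed
  qed
  finally show ?thesis
    by (simp add: n_def)
qed

section \<open>Null sets in polar coordinates\<close>

lemma AE_polar_iff:
  fixes P :: "'a::euclidean_space \<Rightarrow> bool"
  assumes [measurable]: "Measurable.pred borel P"
  shows "(AE r in mult_haar. AE \<theta> in sphere_measure. P (r *\<^sub>R \<theta>)) \<longleftrightarrow> (AE x in lborel. P x)"
    and "(AE \<theta> in sphere_measure. AE r in mult_haar. P (r *\<^sub>R \<theta>)) \<longleftrightarrow> (AE x in lborel. P x)"
proof -
  interpret pair_sigma_finite mult_haar "sphere_measure :: 'a measure"
    by (rule pair_sigma_finite_mult_haar_sphere)
  \<comment> \<open>The indicator of the complement of \<open>P\<close>: its integral vanishes
    exactly when \<open>P\<close> holds almost everywhere, and the factor \<open>r ^ DIM('a)\<close>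
    is positive.\<close>
  define u :: "'a \<Rightarrow> ennreal" where "u x = (if P x then 0 else 1)" for x
  have [measurable]: "u \<in> borel_measurable borel"
    unfolding u_def by measurable
  have u: "u x = 0 \<longleftrightarrow> P x" for x
    by (simp add: u_def)
  have "(AE x in lborel. P x) \<longleftrightarrow> (\<integral>\<^sup>+x. u x \<partial>lborel) = 0"
    by (simp add: nn_integral_0_iff_AE u)
  also have "\<dots> \<longleftrightarrow> (AE r in mult_haar. (\<integral>\<^sup>+\<theta>. u (r *\<^sub>R \<theta>) * ennreal (r ^ DIM('a)) \<partial>sphere_measure) = 0)"
    unfolding nn_integral_polar[OF \<open>u \<in> borel_measurable borel\<close>] by (rule nn_integral_0_iff_AE) measurable
  also have "\<dots> \<longleftrightarrow> (AE r in mult_haar. AE \<theta> in sphere_measure. P (r *\<^sub>R \<theta>))"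
  proof (rule eventually_cong[OF AE_mult_haar_pos])
    fix r :: real assume "0 < r"
    have "(\<integral>\<^sup>+\<theta>. u (r *\<^sub>R \<theta>) * ennreal (r ^ DIM('a)) \<partial>sphere_measure) = 0
      \<longleftrightarrow> (AE \<theta> in sphere_measure. u (r *\<^sub>R \<theta>) * ennreal (r ^ DIM('a)) = 0)"
      by (rule nn_integral_0_iff_AE) measurable
    then show "(\<integral>\<^sup>+\<theta>. u (r *\<^sub>R \<theta>) * ennreal (r ^ DIM('a)) \<partial>sphere_measure) = 0
      \<longleftrightarrow> (AE \<theta> in sphere_measure. P (r *\<^sub>R \<theta>))"
      using zero_less_power[OF \<open>0 < r\<close>, of "DIM('a)"] by (simp add: u ennreal_eq_0_iff)
  qed
  finally show *: "(AE r in mult_haar. AE \<theta> in sphere_measure. P (r *\<^sub>R \<theta>)) \<longleftrightarrow> (AE x in lborel. P x)"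
    by simp
  show "(AE \<theta> in sphere_measure. AE r in mult_haar. P (r *\<^sub>R \<theta>)) \<longleftrightarrow> (AE x in lborel. P x)"
    unfolding *[symmetric] by (rule AE_commute[symmetric]) measurable
qed

text \<open>Meant for properties of Lebesgue measurable functions, which need not define Borel sets.
  The exceptional set is enlarged to a Borel null set, which is why only one direction of the
  equivalence remains.\<close>

lemma AE_polar:
  fixes P :: "'a::euclidean_space \<Rightarrow> bool"
  assumes "AE x in lborel. P x"
  shows "AE r in mult_haar. AE \<theta> in sphere_measure. P (r *\<^sub>R \<theta>)"
    and "AE \<theta> in sphere_measure. AE r in mult_haar. P (r *\<^sub>R \<theta>)"
proof -
  obtain N where N: "\<And>x. x \<in> space lborel - N \<Longrightarrow> P x" "N \<in> null_sets lborel"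
    by (rule AE_E3[OF assms]) blast
  then have [measurable]: "N \<in> sets borel" and N': "AE x in lborel. x \<notin> N"
    by (auto intro: AE_not_in)
  have "AE r in mult_haar. AE \<theta> in sphere_measure. r *\<^sub>R \<theta> \<notin> N"
    by (subst AE_polar_iff) (use N' in auto)
  then show "AE r in mult_haar. AE \<theta> in sphere_measure. P (r *\<^sub>R \<theta>)"
    using N(1) by (auto elim!: eventually_mono)
  have "AE \<theta> in sphere_measure. AE r in mult_haar. r *\<^sub>R \<theta> \<notin> N"
    by (subst AE_polar_iff) (use N' in auto)
  then show "AE \<theta> in sphere_measure. AE r in mult_haar. P (r *\<^sub>R \<theta>)"
    using N(1) by (auto elim!: eventually_mono)
qed

text \<open>The cone over a null set of directions is a null set. The origin is set aside because
  \<open>sgn 0 = 0\<close> is not a direction.\<close>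

lemma AE_sphere_imp_AE_sgn:
  fixes P :: "'a::euclidean_space \<Rightarrow> bool"
  assumes "AE \<theta> in sphere_measure. P \<theta>"
  shows "AE x in lborel. P (sgn x)"
proof -
  obtain N where N: "\<And>\<theta>. \<theta> \<in> space sphere_measure - N \<Longrightarrow> P \<theta>"
    "N \<in> null_sets (sphere_measure :: 'a measure)"
    by (rule AE_E3[OF assms]) blast
  have "N \<in> sets borel"
    using N(2) sets_restrict_space_iff[of "sphere 0 1" borel N]
    by (auto simp: null_sets_def sets_sphere_measure)
  have "AE \<theta> in sphere_measure. \<theta> \<notin> N"
    by (rule AE_not_in) fact
  then have "AE \<theta> in sphere_measure. AE r in mult_haar. sgn (r *\<^sub>R \<theta>) \<notin> N"
    using AE_space
  proof eventually_elim
    case (elim \<theta>)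
    show ?case
      using AE_mult_haar_pos
      by (rule eventually_mono) (use elim in \<open>simp add: sgn_scaleR sgn_div_norm space_sphere_measure\<close>)
  qed
  then have "AE x in lborel. sgn x \<notin> N"
    using \<open>N \<in> sets borel\<close> by (subst (asm) AE_polar_iff) auto
  then show ?thesis
    using AE_lborel_singleton[of 0]
  proof eventually_elim
    case (elim x)
    then show ?case
      using N(1) by (auto simp: space_sphere_measure norm_sgn)
  qed
qed

text \<open>The map from \<open>t\<close> to \<open>c / t\<close> preserves null sets of dr/r, and a
  set of radii that is null gives a null set in space. It is needed because the operator evaluates
  \<Phi> on a ray at the parameter \<open>c / norm y\<close>.\<close>

lemma AE_mult_haar_imp_AE_inverse_norm:
  assumes "AE t in mult_haar. P t" "0 < c"
  shows "AE y in (lborel :: 'a::euclidean_space measure). P (c / norm y)"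
proof -
  obtain N where N: "\<And>t. t \<in> space mult_haar - N \<Longrightarrow> P t" "N \<in> null_sets mult_haar"
    by (rule AE_E3[OF assms(1)]) blast
  then have [measurable]: "N \<in> sets borel" by auto
  have meas: "(\<lambda>t. indicator N (c / t) :: ennreal) \<in> borel_measurable mult_haar"
    unfolding measurable_cong_sets[OF sets_mult_haar refl] by measurable
  have "(\<integral>\<^sup>+t. indicator N (c / t) \<partial>mult_haar) = (\<integral>\<^sup>+t. indicator N t \<partial>mult_haar)"
    by (rule nn_integral_mult_haar_reflect) (use \<open>0 < c\<close> in auto)
  also have "\<dots> = 0"
    using N by auto
  finally have "AE t in mult_haar. c / t \<notin> N"
    using meas by (simp add: nn_integral_0_iff_AE indicator_eq_0_iff)
  then have "AE r in mult_haar. AE \<theta> in sphere_measure. c / norm (r *\<^sub>R \<theta> :: 'a) \<notin> N"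
    using AE_mult_haar_pos
  proof eventually_elim
    case (elim r)
    then show ?case by (intro AE_I2) (simp add: space_sphere_measure)
  qed
  then have "AE y in (lborel :: 'a measure). c / norm y \<notin> N"
    by (subst (asm) AE_polar_iff) auto
  then show ?thesis
    using N(1) by (auto elim!: eventually_mono)
qed

section \<open>Estimates for nonnegative Borel functions\<close>

lemma nn_integral_power_weight:
  assumes [measurable]: "X \<in> borel_measurable borel" and "0 < n"
  shows "(\<integral>\<^sup>+r\<in>{0<..}. X r * ennreal (r ^ (n - 1) * r powr \<gamma>) \<partial>lborel)
    = (\<integral>\<^sup>+r. X r * ennreal (r powr (\<gamma> + real n)) \<partial>mult_haar)"
proof -
  have "(\<integral>\<^sup>+r. X r * ennreal (r powr (\<gamma> + real n)) \<partial>mult_haar)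
      = (\<integral>\<^sup>+r. ennreal (indicator {0<..} r / r) * (X r * ennreal (r powr (\<gamma> + real n))) \<partial>lborel)"
    by (rule nn_integral_mult_haar) measurable
  also have "\<dots> = (\<integral>\<^sup>+r\<in>{0<..}. X r * ennreal (r ^ (n - 1) * r powr \<gamma>) \<partial>lborel)"
  proof (rule nn_integral_cong)
    fix r :: real
    show "ennreal (indicator {0<..} r / r) * (X r * ennreal (r powr (\<gamma> + real n)))
        = X r * ennreal (r ^ (n - 1) * r powr \<gamma>) * indicator {0<..} r"
    proof (cases "0 < r")
      case True
      then have "r ^ n = r * r ^ (n - 1)"
        using \<open>0 < n\<close> by (simp add: power_eq_if)
      then have "1 / r * r powr (\<gamma> + real n) = r ^ (n - 1) * r powr \<gamma>"
        using True by (simp add: powr_add powr_realpow)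
      then have "ennreal (1 / r) * ennreal (r powr (\<gamma> + real n)) = ennreal (r ^ (n - 1) * r powr \<gamma>)"
        using True by (simp flip: ennreal_mult)
      then show ?thesis
        using True by (simp add: mult.left_commute)
    qed simp
  qed
  finally show ?thesis by simp
qed

text \<open>Measurability is asked of \<open>Y\<close> alone: \<open>X\<close> will come from
  \<open>hausdorff_op\<close> of Lebesgue measurable functions, whose restrictions to spheres are
  not known to be measurable.\<close>

lemma nn_integral_power_weight_mono:
  assumes "AE r in mult_haar. X r \<le> Y r" "Y \<in> borel_measurable borel" "0 < n"
  shows "(\<integral>\<^sup>+r\<in>{0<..}. X r * ennreal (r ^ (n - 1) * r powr \<gamma>) \<partial>lborel)
    \<le> (\<integral>\<^sup>+r. Y r * ennreal (r powr (\<gamma> + real n)) \<partial>mult_haar)"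
  unfolding nn_integral_power_weight[OF assms(2,3), symmetric]
proof (rule nn_integral_mono_AE)
  show "AE r in lborel. X r * ennreal (r ^ (n - 1) * r powr \<gamma>) * indicator {0<..} r
      \<le> Y r * ennreal (r ^ (n - 1) * r powr \<gamma>) * indicator {0<..} r"
    using assms(1) unfolding AE_mult_haar_iff
    by eventually_elim (auto simp: indicator_def intro!: mult_right_mono)
qed

lemma nn_integral_power_weight_cong:
  assumes "AE r in mult_haar. X r = Y r" "Y \<in> borel_measurable borel" "0 < n"
  shows "(\<integral>\<^sup>+r\<in>{0<..}. X r * ennreal (r ^ (n - 1) * r powr \<gamma>) \<partial>lborel)
    = (\<integral>\<^sup>+r. Y r * ennreal (r powr (\<gamma> + real n)) \<partial>mult_haar)"
  unfolding nn_integral_power_weight[OF assms(2,3), symmetric]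
proof (rule nn_integral_cong_AE)
  show "AE r in lborel. X r * ennreal (r ^ (n - 1) * r powr \<gamma>) * indicator {0<..} r
      = Y r * ennreal (r ^ (n - 1) * r powr \<gamma>) * indicator {0<..} r"
    using assms(1) unfolding AE_mult_haar_iff
    by eventually_elim (auto simp: indicator_def)
qed

text \<open>
  The mixed norms in terms of \<open>dr/r\<close>, where the exponent \<open>a\<close> corresponds to \<open>\<gamma> + n\<close> for the weight \<open>r\<^sup>\<gamma>\<close>.
\<close>

definition haar_rad_ang :: "real \<Rightarrow> real \<Rightarrow> real \<Rightarrow> ('a::euclidean_space \<Rightarrow> ennreal) \<Rightarrow> ennreal" where
  "haar_rad_ang p q a g =
     ennpowr (\<integral>\<^sup>+r. ennpowr (\<integral>\<^sup>+\<theta>. ennpowr (g (r *\<^sub>R \<theta>)) q \<partial>sphere_measure) (p / q)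
       * ennreal (r powr a) \<partial>mult_haar) (1 / p)"

definition haar_ang_rad :: "real \<Rightarrow> real \<Rightarrow> real \<Rightarrow> ('a::euclidean_space \<Rightarrow> ennreal) \<Rightarrow> ennreal" where
  "haar_ang_rad q p a g =
     ennpowr (\<integral>\<^sup>+\<theta>. ennpowr (\<integral>\<^sup>+r. ennpowr (g (r *\<^sub>R \<theta>)) p * ennreal (r powr a) \<partial>mult_haar) (q / p)
       \<partial>sphere_measure) (1 / q)"

lemma measurable_sphere_section [measurable (raw)]:
  fixes g :: "'a::euclidean_space \<Rightarrow> ennreal"
  assumes [measurable]: "g \<in> borel_measurable borel"
  shows "(\<lambda>r. \<integral>\<^sup>+\<theta>. ennpowr (g (r *\<^sub>R \<theta>)) q \<partial>sphere_measure) \<in> borel_measurable borel"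
proof -
  interpret finite_measure "sphere_measure :: 'a measure"
    by (rule finite_measure_sphere_measure)
  show ?thesis by measurable
qed

lemma rad_ang_norm_eq_haar:
  fixes f :: "'a::euclidean_space \<Rightarrow> 'b::real_normed_vector"
  assumes [measurable]: "g \<in> borel_measurable borel"
    and fg: "AE x in lborel. ennreal (norm (f x)) = g x"
  shows "rad_ang_norm p q (\<lambda>r. r powr \<gamma>) f = haar_rad_ang p q (\<gamma> + real DIM('a)) g"
  unfolding rad_ang_norm_def haar_rad_ang_def
proof (intro arg_cong2[where f = ennpowr] refl nn_integral_power_weight_cong)
  show "AE r in mult_haar. ennpowr (\<integral>\<^sup>+\<theta>. ennreal (norm (f (r *\<^sub>R \<theta>)) powr q) \<partial>sphere_measure) (p / q)
      = ennpowr (\<integral>\<^sup>+\<theta>. ennpowr (g (r *\<^sub>R \<theta>)) q \<partial>sphere_measure) (p / q)"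
    using AE_polar(1)[OF fg]
  proof eventually_elim
    case (elim r)
    have "(\<integral>\<^sup>+\<theta>. ennreal (norm (f (r *\<^sub>R \<theta>)) powr q) \<partial>sphere_measure)
        = (\<integral>\<^sup>+\<theta>. ennpowr (g (r *\<^sub>R \<theta>)) q \<partial>sphere_measure)"
      using elim by (intro nn_integral_cong_AE, eventually_elim) (simp add: ennpowr_ennreal[symmetric])
    then show ?case by simp
  qed
qed auto

text \<open>The comparison is assumed along spheres because for the operator it is found direction
  by direction, and it is not known to define a Borel set.\<close>

lemma rad_ang_norm_le_haar:
  fixes f :: "'a::euclidean_space \<Rightarrow> 'b::real_normed_vector"
  assumes [measurable]: "g \<in> borel_measurable borel"
    and fg: "AE r in mult_haar. AE \<theta> in sphere_measure. ennreal (norm (f (r *\<^sub>R \<theta>))) \<le> g (r *\<^sub>R \<theta>)"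
    and "0 \<le> p" "0 \<le> q"
  shows "rad_ang_norm p q (\<lambda>r. r powr \<gamma>) f \<le> haar_rad_ang p q (\<gamma> + real DIM('a)) g"
  unfolding rad_ang_norm_def haar_rad_ang_def
proof (intro ennpowr_mono nn_integral_power_weight_mono)
  show "AE r in mult_haar. ennpowr (\<integral>\<^sup>+\<theta>. ennreal (norm (f (r *\<^sub>R \<theta>)) powr q) \<partial>sphere_measure) (p / q)
      \<le> ennpowr (\<integral>\<^sup>+\<theta>. ennpowr (g (r *\<^sub>R \<theta>)) q \<partial>sphere_measure) (p / q)"
    using fg
  proof eventually_elim
    case (elim r)
    have "(\<integral>\<^sup>+\<theta>. ennreal (norm (f (r *\<^sub>R \<theta>)) powr q) \<partial>sphere_measure)
        \<le> (\<integral>\<^sup>+\<theta>. ennpowr (g (r *\<^sub>R \<theta>)) q \<partial>sphere_measure)"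
      using elim
      by (intro nn_integral_mono_AE, eventually_elim)
        (use \<open>0 \<le> q\<close> in \<open>simp add: ennpowr_ennreal[symmetric] ennpowr_mono\<close>)
    then show ?case
      using assms by (intro ennpowr_mono) auto
  qed
qed (use assms in auto)

lemma ang_rad_norm_eq_haar:
  fixes f :: "'a::euclidean_space \<Rightarrow> 'b::real_normed_vector"
  assumes [measurable]: "g \<in> borel_measurable borel"
    and fg: "AE x in lborel. ennreal (norm (f x)) = g x"
  shows "ang_rad_norm q p (\<lambda>r. r powr \<gamma>) f = haar_ang_rad q p (\<gamma> + real DIM('a)) g"
proof -
  have "(\<integral>\<^sup>+\<theta>. ennpowr (\<integral>\<^sup>+r\<in>{0<..}. ennreal (norm (f (r *\<^sub>R \<theta>)) powr p * r ^ (DIM('a) - 1) * r powr \<gamma>) \<partial>lborel) (q / p)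
        \<partial>sphere_measure)
      = (\<integral>\<^sup>+\<theta>. ennpowr (\<integral>\<^sup>+r. ennpowr (g (r *\<^sub>R \<theta>)) p * ennreal (r powr (\<gamma> + real DIM('a))) \<partial>mult_haar) (q / p)
        \<partial>sphere_measure)"
  proof (rule nn_integral_cong_AE)
    show "AE \<theta> in sphere_measure.
        ennpowr (\<integral>\<^sup>+r\<in>{0<..}. ennreal (norm (f (r *\<^sub>R \<theta>)) powr p * r ^ (DIM('a) - 1) * r powr \<gamma>) \<partial>lborel) (q / p)
      = ennpowr (\<integral>\<^sup>+r. ennpowr (g (r *\<^sub>R \<theta>)) p * ennreal (r powr (\<gamma> + real DIM('a))) \<partial>mult_haar) (q / p)"
      using AE_polar(2)[OF fg]
    proof eventually_elim
      case (elim \<theta>)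
      have "(\<integral>\<^sup>+r\<in>{0<..}. ennreal (norm (f (r *\<^sub>R \<theta>)) powr p * r ^ (DIM('a) - 1) * r powr \<gamma>) \<partial>lborel)
          = (\<integral>\<^sup>+r\<in>{0<..}. ennreal (norm (f (r *\<^sub>R \<theta>)) powr p) * ennreal (r ^ (DIM('a) - 1) * r powr \<gamma>) \<partial>lborel)"
        by (intro nn_integral_cong) (auto simp: indicator_def mult.assoc simp flip: ennreal_mult)
      also have "\<dots> = (\<integral>\<^sup>+r. ennpowr (g (r *\<^sub>R \<theta>)) p * ennreal (r powr (\<gamma> + real DIM('a))) \<partial>mult_haar)"
      proof (rule nn_integral_power_weight_cong)
        show "AE r in mult_haar. ennreal (norm (f (r *\<^sub>R \<theta>)) powr p) = ennpowr (g (r *\<^sub>R \<theta>)) p"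
          using elim by eventually_elim (simp add: ennpowr_ennreal[symmetric])
      qed auto
      finally show ?case by simp
    qed
  qed
  then show ?thesis
    by (simp add: ang_rad_norm_def haar_ang_rad_def)
qed

section \<open>The operator on moduli, finite exactly where the integral converges
  absolutely\<close>

definition hausdorff_majorant ::
  "('a::euclidean_space \<Rightarrow> ennreal) \<Rightarrow> real \<Rightarrow> ('a \<Rightarrow> ennreal) \<Rightarrow> 'a \<Rightarrow> ennreal" where
  "hausdorff_majorant g \<beta> u x =
     (\<integral>\<^sup>+y. g (x /\<^sub>R norm y) * ennreal (norm y powr (\<beta> - real DIM('a))) * u y \<partial>lborel)"

lemma measurable_hausdorff_majorant [measurable]:
  assumes [measurable]: "g \<in> borel_measurable borel" "u \<in> borel_measurable borel"
  shows "hausdorff_majorant g \<beta> u \<in> borel_measurable borel"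
  unfolding hausdorff_majorant_def[abs_def] by measurable

lemma hausdorff_majorant_polar:
  fixes g u :: "'a::euclidean_space \<Rightarrow> ennreal"
  assumes [measurable]: "g \<in> borel_measurable borel" "u \<in> borel_measurable borel"
  shows "hausdorff_majorant g \<beta> u (\<rho> *\<^sub>R \<theta>)
    = (\<integral>\<^sup>+r. g ((\<rho> / r) *\<^sub>R \<theta>) * ennreal (r powr \<beta>) * (\<integral>\<^sup>+\<omega>. u (r *\<^sub>R \<omega>) \<partial>sphere_measure) \<partial>mult_haar)"
proof -
  have "hausdorff_majorant g \<beta> u (\<rho> *\<^sub>R \<theta>)
      = (\<integral>\<^sup>+r. (\<integral>\<^sup>+\<omega>. g ((\<rho> *\<^sub>R \<theta>) /\<^sub>R norm (r *\<^sub>R \<omega>))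
          * ennreal (norm (r *\<^sub>R \<omega>) powr (\<beta> - real DIM('a))) * u (r *\<^sub>R \<omega>)
          * ennreal (r ^ DIM('a)) \<partial>sphere_measure) \<partial>mult_haar)"
    unfolding hausdorff_majorant_def by (rule nn_integral_polar) measurable
  also have "\<dots> = (\<integral>\<^sup>+r. g ((\<rho> / r) *\<^sub>R \<theta>) * ennreal (r powr \<beta>)
      * (\<integral>\<^sup>+\<omega>. u (r *\<^sub>R \<omega>) \<partial>sphere_measure) \<partial>mult_haar)"
  proof (rule nn_integral_cong_AE)
    show "AE r in mult_haar. (\<integral>\<^sup>+\<omega>. g ((\<rho> *\<^sub>R \<theta>) /\<^sub>R norm (r *\<^sub>R \<omega>))
          * ennreal (norm (r *\<^sub>R \<omega>) powr (\<beta> - real DIM('a))) * u (r *\<^sub>R \<omega>)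
          * ennreal (r ^ DIM('a)) \<partial>sphere_measure)
        = g ((\<rho> / r) *\<^sub>R \<theta>) * ennreal (r powr \<beta>) * (\<integral>\<^sup>+\<omega>. u (r *\<^sub>R \<omega>) \<partial>sphere_measure)"
      using AE_mult_haar_pos
    proof eventually_elim
      case (elim r)
      have "r powr (\<beta> - real DIM('a)) * r ^ DIM('a) = r powr \<beta>"
        using elim by (simp add: powr_diff powr_realpow)
      then have w: "ennreal (r powr (\<beta> - real DIM('a))) * ennreal (r ^ DIM('a)) = ennreal (r powr \<beta>)"
        using elim by (simp flip: ennreal_mult)
      have "(\<integral>\<^sup>+\<omega>. g ((\<rho> *\<^sub>R \<theta>) /\<^sub>R norm (r *\<^sub>R \<omega>))
          * ennreal (norm (r *\<^sub>R \<omega>) powr (\<beta> - real DIM('a))) * u (r *\<^sub>R \<omega>)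
          * ennreal (r ^ DIM('a)) \<partial>sphere_measure)
        = (\<integral>\<^sup>+\<omega>. g ((\<rho> / r) *\<^sub>R \<theta>) * ennreal (r powr \<beta>) * u (r *\<^sub>R \<omega>) \<partial>sphere_measure)"
        using elim w[symmetric]
        by (intro nn_integral_cong) (simp add: space_sphere_measure field_simps)
      also have "\<dots> = g ((\<rho> / r) *\<^sub>R \<theta>) * ennreal (r powr \<beta>) * (\<integral>\<^sup>+\<omega>. u (r *\<^sub>R \<omega>) \<partial>sphere_measure)"
        by (rule nn_integral_cmult) measurable
      finally show ?case .
    qed
  qed
  finally show ?thesis .
qed

text \<open>
  Young's inequality on \<open>(0,\<infinity>)\<close>, with the weight distributed as \<open>\<rho>\<^sup>A = (\<rho>/r)\<^sup>A r\<^sup>A\<close> for \<open>A = a/p\<^sub>2\<close>.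
\<close>

lemma hausdorff_majorant_radial_bound:
  fixes g u :: "'a::euclidean_space \<Rightarrow> ennreal"
  assumes [measurable]: "g \<in> borel_measurable borel" "u \<in> borel_measurable borel"
    and "1 \<le> p\<^sub>1" "1 \<le> s" "p\<^sub>1 \<le> p\<^sub>2" "s \<le> p\<^sub>2" "1 / p\<^sub>2 + 1 = 1 / s + 1 / p\<^sub>1"
    and b: "b = p\<^sub>1 * (a / p\<^sub>2 + \<beta>)"
  shows "ennpowr (\<integral>\<^sup>+\<rho>. ennpowr (hausdorff_majorant g \<beta> u (\<rho> *\<^sub>R \<theta>)) p\<^sub>2 * ennreal (\<rho> powr a) \<partial>mult_haar) (1 / p\<^sub>2)
    \<le> ennpowr (\<integral>\<^sup>+t. ennpowr (g (t *\<^sub>R \<theta>)) s * ennreal (t powr (a * s / p\<^sub>2)) \<partial>mult_haar) (1 / s)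
      * haar_rad_ang p\<^sub>1 1 b u"
proof -
  define A where "A = a / p\<^sub>2"
  define F where "F r = (\<integral>\<^sup>+\<omega>. u (r *\<^sub>R \<omega>) \<partial>sphere_measure)" for r
  have [measurable]: "F \<in> borel_measurable borel"
    unfolding F_def[abs_def] using measurable_sphere_section[of u 1] by simp
  define G where "G t = g (t *\<^sub>R \<theta>) * ennreal (t powr A)" for t
  have [measurable]: "G \<in> borel_measurable borel"
    unfolding G_def[abs_def] by measurable
  define h where "h r = F r * ennreal (r powr (A + \<beta>))" for r
  have [measurable]: "h \<in> borel_measurable borel"
    unfolding h_def[abs_def] by measurable
  have G: "ennpowr (G t) s = ennpowr (g (t *\<^sub>R \<theta>)) s * ennreal (t powr (a * s / p\<^sub>2))" for t
    by (simp add: G_def A_def ennpowr_mult ennpowr_ennreal powr_powr)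
  \<comment> \<open>Here the scaling hypothesis enters: for \<open>a = \<gamma> + n\<close> it says
    \<open>b = \<alpha> + n\<close>, so the power left on F is the weight of the norm of f.\<close>
  have "A + \<beta> = b / p\<^sub>1"
    using assms by (simp add: A_def)
  then have h: "ennpowr (h r) p\<^sub>1 = ennpowr (F r) p\<^sub>1 * ennreal (r powr b)" for r
    using assms(3) by (simp add: h_def ennpowr_mult ennpowr_ennreal powr_powr)
  have "ennpowr (\<integral>\<^sup>+\<rho>. ennpowr (\<integral>\<^sup>+r. G (\<rho> / r) * h r \<partial>mult_haar) p\<^sub>2 \<partial>mult_haar) (1 / p\<^sub>2)
    \<le> ennpowr (\<integral>\<^sup>+t. ennpowr (G t) s \<partial>mult_haar) (1 / s) * ennpowr (\<integral>\<^sup>+r. ennpowr (h r) p\<^sub>1 \<partial>mult_haar) (1 / p\<^sub>1)"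
  proof (rule nn_integral_young[OF sigma_finite_mult_haar sigma_finite_mult_haar assms(3-7)])
    \<comment> \<open>The two kernel bounds are the two invariances of dr/r: under \<open>r\<close>
      to \<open>\<rho> / r\<close> for fixed \<open>\<rho>\<close>, and under dilation for fixed
      \<open>r\<close>.\<close>
    show "AE \<rho> in mult_haar. (\<integral>\<^sup>+r. ennpowr (G (\<rho> / r)) s \<partial>mult_haar) \<le> (\<integral>\<^sup>+t. ennpowr (G t) s \<partial>mult_haar)"
      using AE_mult_haar_pos
    proof eventually_elim
      case (elim \<rho>)
      then show ?case
        using nn_integral_mult_haar_reflect[of "\<lambda>t. ennpowr (G t) s" \<rho>] by simp
    qed
    show "AE r in mult_haar. (\<integral>\<^sup>+\<rho>. ennpowr (G (\<rho> / r)) s \<partial>mult_haar) \<le> (\<integral>\<^sup>+t. ennpowr (G t) s \<partial>mult_haar)"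
      using AE_mult_haar_pos
    proof eventually_elim
      case (elim r)
      then show ?case
        using nn_integral_mult_haar_scale[of "\<lambda>t. ennpowr (G t) s" "1 / r"] by simp
    qed
    show "(\<lambda>(\<rho>, r). G (\<rho> / r)) \<in> borel_measurable (mult_haar \<Otimes>\<^sub>M mult_haar)"
      by measurable
    show "h \<in> borel_measurable mult_haar"
      by (simp add: measurable_cong_sets[OF sets_mult_haar refl])
  qed
  also have "(\<integral>\<^sup>+\<rho>. ennpowr (\<integral>\<^sup>+r. G (\<rho> / r) * h r \<partial>mult_haar) p\<^sub>2 \<partial>mult_haar)
      = (\<integral>\<^sup>+\<rho>. ennpowr (hausdorff_majorant g \<beta> u (\<rho> *\<^sub>R \<theta>)) p\<^sub>2 * ennreal (\<rho> powr a) \<partial>mult_haar)"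
  proof (rule nn_integral_cong_AE)
    show "AE \<rho> in mult_haar. ennpowr (\<integral>\<^sup>+r. G (\<rho> / r) * h r \<partial>mult_haar) p\<^sub>2
        = ennpowr (hausdorff_majorant g \<beta> u (\<rho> *\<^sub>R \<theta>)) p\<^sub>2 * ennreal (\<rho> powr a)"
      using AE_mult_haar_pos
    proof eventually_elim
      case (elim \<rho>)
      have "(\<integral>\<^sup>+r. G (\<rho> / r) * h r \<partial>mult_haar)
          = (\<integral>\<^sup>+r. ennreal (\<rho> powr A) * (g ((\<rho> / r) *\<^sub>R \<theta>) * ennreal (r powr \<beta>) * F r) \<partial>mult_haar)"
      proof (rule nn_integral_cong_AE)
        show "AE r in mult_haar. G (\<rho> / r) * h r
            = ennreal (\<rho> powr A) * (g ((\<rho> / r) *\<^sub>R \<theta>) * ennreal (r powr \<beta>) * F r)"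
          using AE_mult_haar_pos
        proof (rule eventually_mono)
          fix r :: real assume "0 < r"
          then have "(\<rho> / r) powr A * r powr (A + \<beta>) = \<rho> powr A * r powr \<beta>"
            using elim by (simp add: powr_divide powr_add)
          then have "ennreal ((\<rho> / r) powr A) * ennreal (r powr (A + \<beta>)) = ennreal (\<rho> powr A) * ennreal (r powr \<beta>)"
            by (simp flip: ennreal_mult)
          moreover have "G (\<rho> / r) * h r
              = g ((\<rho> / r) *\<^sub>R \<theta>) * F r * (ennreal ((\<rho> / r) powr A) * ennreal (r powr (A + \<beta>)))"
            by (simp only: G_def h_def mult_ac)
          ultimately show "G (\<rho> / r) * h r
            = ennreal (\<rho> powr A) * (g ((\<rho> / r) *\<^sub>R \<theta>) * ennreal (r powr \<beta>) * F r)"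
            by (simp only: mult_ac)
        qed
      qed
      also have "\<dots> = ennreal (\<rho> powr A) * hausdorff_majorant g \<beta> u (\<rho> *\<^sub>R \<theta>)"
        unfolding hausdorff_majorant_polar[OF assms(1,2)] F_def[symmetric]
        by (rule nn_integral_cmult) (subst measurable_cong_sets[OF sets_mult_haar refl], measurable)
      finally show ?case
        using assms by (simp add: ennpowr_mult ennpowr_ennreal powr_powr A_def mult.commute)
    qed
  qed
  finally show ?thesis
    by (simp add: G h haar_rad_ang_def F_def)
qed

text \<open>Minkowski's inequality is applied to the \<open>q\<close>-th power of the majorant with
  exponent \<open>p\<^sub>2 / q\<close>, which is at least 1. The weight is inserted with exponent
  \<open>a * q / p\<^sub>2\<close>, so that the power \<open>p\<^sub>2 / q\<close> restores
  \<open>a\<close>. The factor coming from \<open>u\<close> is the same for all directions and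
  leaves the angular integral.\<close>

lemma hausdorff_majorant_bound:
  fixes g u :: "'a::euclidean_space \<Rightarrow> ennreal"
  assumes [measurable]: "g \<in> borel_measurable borel" "u \<in> borel_measurable borel"
    and "1 \<le> p\<^sub>1" "1 \<le> s" "p\<^sub>1 \<le> p\<^sub>2" "s \<le> p\<^sub>2" "1 / p\<^sub>2 + 1 = 1 / s + 1 / p\<^sub>1"
    and "1 \<le> q" "q \<le> p\<^sub>2"
    and "b = p\<^sub>1 * (a / p\<^sub>2 + \<beta>)"
  shows "haar_rad_ang p\<^sub>2 q a (hausdorff_majorant g \<beta> u)
    \<le> haar_ang_rad q s (a * s / p\<^sub>2) g * haar_rad_ang p\<^sub>1 1 b u"
proof -
  interpret S: finite_measure "sphere_measure :: 'a measure"
    by (rule finite_measure_sphere_measure)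
  interpret H: sigma_finite_measure mult_haar
    by (rule sigma_finite_mult_haar)
  define K where "K = hausdorff_majorant g \<beta> u"
  have [measurable]: "K \<in> borel_measurable borel"
    unfolding K_def by measurable
  define T where "T \<theta> = (\<integral>\<^sup>+t. ennpowr (g (t *\<^sub>R \<theta>)) s * ennreal (t powr (a * s / p\<^sub>2)) \<partial>mult_haar)" for \<theta>
  have [measurable]: "T \<in> borel_measurable borel"
    unfolding T_def[abs_def] by measurable
  define P where "P = haar_rad_ang p\<^sub>1 1 b u"
  define f where "f r \<theta> = ennpowr (K (r *\<^sub>R \<theta>)) q * ennreal (r powr (a * q / p\<^sub>2))" for r \<theta>
  have f: "ennpowr (f r \<theta>) (p\<^sub>2 / q) = ennpowr (K (r *\<^sub>R \<theta>)) p\<^sub>2 * ennreal (r powr a)" for r \<theta>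
    using assms(3,5,8) by (simp add: f_def ennpowr_mult ennpowr_ennpowr ennpowr_ennreal powr_powr)
  have "ennpowr (\<integral>\<^sup>+r. ennpowr (\<integral>\<^sup>+\<theta>. f r \<theta> \<partial>sphere_measure) (p\<^sub>2 / q) \<partial>mult_haar) (1 / (p\<^sub>2 / q))
      \<le> (\<integral>\<^sup>+\<theta>. ennpowr (\<integral>\<^sup>+r. ennpowr (f r \<theta>) (p\<^sub>2 / q) \<partial>mult_haar) (1 / (p\<^sub>2 / q)) \<partial>sphere_measure)"
  proof (rule nn_integral_minkowski)
    show "case_prod f \<in> borel_measurable (mult_haar \<Otimes>\<^sub>M sphere_measure)"
      unfolding f_def by measurable
  qed (use assms in \<open>auto simp: sigma_finite_mult_haar S.sigma_finite_measure_axioms\<close>)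
  also have "(\<integral>\<^sup>+r. ennpowr (\<integral>\<^sup>+\<theta>. f r \<theta> \<partial>sphere_measure) (p\<^sub>2 / q) \<partial>mult_haar)
      = (\<integral>\<^sup>+r. ennpowr (\<integral>\<^sup>+\<theta>. ennpowr (K (r *\<^sub>R \<theta>)) q \<partial>sphere_measure) (p\<^sub>2 / q) * ennreal (r powr a) \<partial>mult_haar)"
    using assms(3,5,8)
    by (simp add: f_def nn_integral_multc ennpowr_mult ennpowr_ennreal powr_powr)
  also have "(\<integral>\<^sup>+\<theta>. ennpowr (\<integral>\<^sup>+r. ennpowr (f r \<theta>) (p\<^sub>2 / q) \<partial>mult_haar) (1 / (p\<^sub>2 / q)) \<partial>sphere_measure)
      \<le> (\<integral>\<^sup>+\<theta>. ennpowr (T \<theta>) (q / s) * ennpowr P q \<partial>sphere_measure)"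
  proof (rule nn_integral_mono)
    fix \<theta> :: 'a
    have "ennpowr (\<integral>\<^sup>+r. ennpowr (f r \<theta>) (p\<^sub>2 / q) \<partial>mult_haar) (1 / p\<^sub>2) \<le> ennpowr (T \<theta>) (1 / s) * P"
      unfolding f T_def P_def K_def by (rule hausdorff_majorant_radial_bound) (use assms in auto)
    from ennpowr_mono[OF this, of q]
    show "ennpowr (\<integral>\<^sup>+r. ennpowr (f r \<theta>) (p\<^sub>2 / q) \<partial>mult_haar) (1 / (p\<^sub>2 / q)) \<le> ennpowr (T \<theta>) (q / s) * ennpowr P q"
      using assms(8) by (simp add: ennpowr_mult ennpowr_ennpowr)
  qed
  also have "\<dots> = (\<integral>\<^sup>+\<theta>. ennpowr (T \<theta>) (q / s) \<partial>sphere_measure) * ennpowr P q"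
    by (rule nn_integral_multc) measurable
  finally have "ennpowr (ennpowr (\<integral>\<^sup>+r. ennpowr (\<integral>\<^sup>+\<theta>. ennpowr (K (r *\<^sub>R \<theta>)) q \<partial>sphere_measure) (p\<^sub>2 / q)
        * ennreal (r powr a) \<partial>mult_haar) (1 / (p\<^sub>2 / q))) (1 / q)
      \<le> ennpowr ((\<integral>\<^sup>+\<theta>. ennpowr (T \<theta>) (q / s) \<partial>sphere_measure) * ennpowr P q) (1 / q)"
    by (rule ennpowr_mono) (use assms in simp)
  then show ?thesis
    using assms(8) by (simp add: haar_rad_ang_def haar_ang_rad_def K_def T_def P_def ennpowr_mult ennpowr_ennpowr)
qed

section \<open>Comparison of the norms of f with the one of angular exponent 1\<close>

lemma haar_rad_ang_le_ang_rad:
  fixes u :: "'a::euclidean_space \<Rightarrow> ennreal"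
  assumes [measurable]: "u \<in> borel_measurable borel" and "1 \<le> p"
  shows "haar_rad_ang p 1 b u \<le> haar_ang_rad 1 p b u"
proof -
  interpret S: finite_measure "sphere_measure :: 'a measure"
    by (rule finite_measure_sphere_measure)
  \<comment> \<open>The weight is taken inside the \<open>p\<close>-th power, so that the unweighted
    Minkowski inequality applies.\<close>
  define f where "f r \<theta> = u (r *\<^sub>R \<theta>) * ennreal (r powr (b / p))" for r \<theta>
  have "ennpowr (\<integral>\<^sup>+r. ennpowr (\<integral>\<^sup>+\<theta>. f r \<theta> \<partial>sphere_measure) p \<partial>mult_haar) (1 / p)
      \<le> (\<integral>\<^sup>+\<theta>. ennpowr (\<integral>\<^sup>+r. ennpowr (f r \<theta>) p \<partial>mult_haar) (1 / p) \<partial>sphere_measure)"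
  proof (rule nn_integral_minkowski)
    show "case_prod f \<in> borel_measurable (mult_haar \<Otimes>\<^sub>M sphere_measure)"
      unfolding f_def by measurable
  qed (use assms in \<open>auto simp: sigma_finite_mult_haar S.sigma_finite_measure_axioms\<close>)
  then show ?thesis
    using \<open>1 \<le> p\<close>
    by (simp add: f_def nn_integral_multc ennpowr_mult ennpowr_ennreal powr_powr haar_rad_ang_def haar_ang_rad_def)
qed

lemma haar_rad_ang_one_le:
  fixes u :: "'a::euclidean_space \<Rightarrow> ennreal"
  assumes [measurable]: "u \<in> borel_measurable borel" and "1 \<le> p" "1 \<le> q"
  shows "haar_rad_ang p 1 b u \<le> sphere_embedding_const TYPE('a) q * haar_rad_ang p q b u"
proof -
  interpret S: finite_measure "sphere_measure :: 'a measure"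
    by (rule finite_measure_sphere_measure)
  define c where "c = emeasure (sphere_measure :: 'a measure) (sphere 0 1)"
  have c: "c = emeasure (sphere_measure :: 'a measure) (space sphere_measure)"
    by (simp add: c_def space_sphere_measure)
  \<comment> \<open>Hoelder on one sphere at a time: the constant does not depend on
    \<open>r\<close> and therefore comes out of the radial norm with power 1.\<close>
  have "(\<integral>\<^sup>+\<theta>. u (r *\<^sub>R \<theta>) \<partial>sphere_measure)
      \<le> ennpowr c (1 - 1 / q) * ennpowr (\<integral>\<^sup>+\<theta>. ennpowr (u (r *\<^sub>R \<theta>)) q \<partial>sphere_measure) (1 / q)" for r
  proof -
    have "ennpowr (\<integral>\<^sup>+\<theta>. u (r *\<^sub>R \<theta>) \<partial>sphere_measure) q
        \<le> ennpowr c (q - 1) * (\<integral>\<^sup>+\<theta>. ennpowr (u (r *\<^sub>R \<theta>)) q \<partial>sphere_measure)"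
      unfolding c
      by (rule hoelder_const) (use assms emeasure_sphere_measure_pos[where 'a = 'a] in
          \<open>auto simp: space_sphere_measure less_top[symmetric] S.emeasure_finite\<close>)
    then have "(\<integral>\<^sup>+\<theta>. u (r *\<^sub>R \<theta>) \<partial>sphere_measure)
        \<le> ennpowr (ennpowr c (q - 1) * (\<integral>\<^sup>+\<theta>. ennpowr (u (r *\<^sub>R \<theta>)) q \<partial>sphere_measure)) (1 / q)"
      using \<open>1 \<le> q\<close> by (subst ennpowr_le_iff_le_root[symmetric]) auto
    moreover have "(q - 1) / q = 1 - 1 / q"
      using \<open>1 \<le> q\<close> by (simp add: field_simps)
    ultimately show ?thesis
      by (simp add: ennpowr_mult ennpowr_ennpowr)
  qed
  then have "(\<integral>\<^sup>+r. ennpowr (\<integral>\<^sup>+\<theta>. u (r *\<^sub>R \<theta>) \<partial>sphere_measure) p * ennreal (r powr b) \<partial>mult_haar)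
    \<le> (\<integral>\<^sup>+r. ennpowr (ennpowr c (1 - 1 / q) * ennpowr (\<integral>\<^sup>+\<theta>. ennpowr (u (r *\<^sub>R \<theta>)) q \<partial>sphere_measure) (1 / q)) p
        * ennreal (r powr b) \<partial>mult_haar)"
    using \<open>1 \<le> p\<close> by (intro nn_integral_mono mult_right_mono ennpowr_mono) auto
  also have "\<dots> = (\<integral>\<^sup>+r. ennpowr (ennpowr c (1 - 1 / q)) p
      * (ennpowr (\<integral>\<^sup>+\<theta>. ennpowr (u (r *\<^sub>R \<theta>)) q \<partial>sphere_measure) (p / q) * ennreal (r powr b)) \<partial>mult_haar)"
    by (simp add: ennpowr_mult ennpowr_ennpowr mult.assoc)
  also have "\<dots> = ennpowr (ennpowr c (1 - 1 / q)) p
      * (\<integral>\<^sup>+r. ennpowr (\<integral>\<^sup>+\<theta>. ennpowr (u (r *\<^sub>R \<theta>)) q \<partial>sphere_measure) (p / q) * ennreal (r powr b) \<partial>mult_haar)"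
    by (rule nn_integral_cmult) (subst measurable_cong_sets[OF sets_mult_haar refl], measurable)
  finally have "haar_rad_ang p 1 b u \<le> ennpowr c (1 - 1 / q) * haar_rad_ang p q b u"
    using ennpowr_mono[of _ _ "1 / p"] \<open>1 \<le> p\<close>
    by (fastforce simp: haar_rad_ang_def ennpowr_mult ennpowr_ennpowr)
  also have "ennpowr c (1 - 1 / q) = sphere_embedding_const TYPE('a) q"
    by (simp add: c_def sphere_embedding_const_def S.emeasure_eq_measure ennpowr_ennreal)
  finally show ?thesis .
qed

section \<open>Lebesgue measurable functions\<close>

lemma measurable_completion_cong_AE:
  assumes f: "f \<in> borel_measurable M" and eq: "AE x in M. g x = f x"
  shows "g \<in> borel_measurable (completion M)"
proof (rule measurableI)
  fix A :: "'b set" assume A: "A \<in> sets borel"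
  show "g -` A \<inter> space (completion M) \<in> sets (completion M)"
  proof (rule completion.in_sets_AE)
    show "f -` A \<inter> space M \<in> sets (completion M)"
      using measurable_sets[OF measurable_completion[OF f] A] by simp
    have "AE x in M. x \<in> f -` A \<inter> space M \<longleftrightarrow> x \<in> g -` A \<inter> space (completion M)"
      using eq by eventually_elim auto
    then show "AE x in completion M. x \<in> f -` A \<inter> space M \<longleftrightarrow> x \<in> g -` A \<inter> space (completion M)"
      by (rule AE_completion)
  qed auto
qed auto

lemma completion_ex_borel_measurable_complex:
  fixes g :: "'a \<Rightarrow> complex"
  assumes [measurable]: "g \<in> borel_measurable (completion M)"
  obtains g' where "g' \<in> borel_measurable M" "AE x in M. g x = g' x"
proof -
  have "(\<lambda>x. Re (g x)) \<in> borel_measurable (completion M)" "(\<lambda>x. Im (g x)) \<in> borel_measurable (completion M)"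
    by measurable
  then obtain a b where [measurable]: "a \<in> borel_measurable M" "b \<in> borel_measurable M"
    and ab: "AE x in M. Re (g x) = a x" "AE x in M. Im (g x) = b x"
    by (blast dest: completion_ex_borel_measurable_real)
  show thesis
  proof
    show "(\<lambda>x. complex_of_real (a x) + \<i> * complex_of_real (b x)) \<in> borel_measurable M"
      by measurable
    show "AE x in M. g x = complex_of_real (a x) + \<i> * complex_of_real (b x)"
      using ab by eventually_elim (simp add: complex_eq_iff)
  qed
qed

text \<open>Valid without integrability, since the Bochner integral is 0 when it does not exist.
  This allows the norm of the operator to be bounded before integrability is established.\<close>

lemma norm_integral_le_nn_integral:
  "ennreal (norm (integral\<^sup>L M f)) \<le> (\<integral>\<^sup>+x. ennreal (norm (f x)) \<partial>M)"
  by (cases "integrable M f") (auto simp: integral_norm_bound_ennreal not_integrable_integral_eq)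

lemma ennreal_norm_hausdorff_integrand:
  fixes \<Phi> f :: "'a::euclidean_space \<Rightarrow> complex"
  shows "ennreal (norm (hausdorff_integrand \<Phi> \<beta> f x y))
    = ennreal (norm (\<Phi> (x /\<^sub>R norm y))) * ennreal (norm y powr (\<beta> - real DIM('a))) * ennreal (norm (f y))"
proof -
  \<comment> \<open>Valid at \<open>y = 0\<close> too, where division by 0 and powers of 0 are both
    0.\<close>
  have "norm (hausdorff_integrand \<Phi> \<beta> f x y)
      = norm (\<Phi> (x /\<^sub>R norm y)) * norm y powr (\<beta> - real DIM('a)) * norm (f y)"
    using powr_minus_divide[of "norm y" "real DIM('a) - \<beta>"]
    by (simp add: hausdorff_integrand_def norm_mult norm_divide)
  then show ?thesis
    by (simp add: ennreal_mult)
qed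

text \<open>The exceptional directions do not depend on \<open>r\<close>. The result can thus be
  used on a sphere of fixed radius, for the norm, and at almost every \<open>x\<close> through
  \<open>sgn x\<close>, for integrability.\<close>

lemma AE_hausdorff_integrand_cong:
  fixes \<Phi> \<Phi>' f f' :: "'a::euclidean_space \<Rightarrow> complex"
  assumes \<Phi>: "AE x in lborel. \<Phi> x = \<Phi>' x" and f: "AE x in lborel. f x = f' x"
  shows "AE \<theta> in sphere_measure. \<forall>r>0.
    AE y in lborel. hausdorff_integrand \<Phi> \<beta> f (r *\<^sub>R \<theta>) y = hausdorff_integrand \<Phi>' \<beta> f' (r *\<^sub>R \<theta>) y"
  using AE_polar(2)[OF \<Phi>]
proof (rule eventually_mono, intro allI impI)
  fix \<theta> :: 'a and r :: real
  assume "AE t in mult_haar. \<Phi> (t *\<^sub>R \<theta>) = \<Phi>' (t *\<^sub>R \<theta>)" and "0 < r"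
  then have "AE y in (lborel :: 'a measure). \<Phi> ((r / norm y) *\<^sub>R \<theta>) = \<Phi>' ((r / norm y) *\<^sub>R \<theta>)"
    by (rule AE_mult_haar_imp_AE_inverse_norm)
  then show "AE y in lborel. hausdorff_integrand \<Phi> \<beta> f (r *\<^sub>R \<theta>) y = hausdorff_integrand \<Phi>' \<beta> f' (r *\<^sub>R \<theta>) y"
    using f by eventually_elim (simp add: hausdorff_integrand_def divide_inverse mult.commute)
qed

text \<open>Turns the norm estimate into integrability. Finiteness passes through both integrals
  because \<open>ennpowr\<close> is infinite only at infinity and the weight is positive.\<close>

lemma haar_rad_ang_finite_imp_AE_finite:
  fixes g :: "'a::euclidean_space \<Rightarrow> ennreal"
  assumes [measurable]: "g \<in> borel_measurable borel" and "haar_rad_ang p q a g < top"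
  shows "AE x in lborel. g x < top"
proof -
  have "(\<integral>\<^sup>+r. ennpowr (\<integral>\<^sup>+\<theta>. ennpowr (g (r *\<^sub>R \<theta>)) q \<partial>sphere_measure) (p / q) * ennreal (r powr a) \<partial>mult_haar) \<noteq> \<infinity>"
    using assms(2) by (auto simp: haar_rad_ang_def)
  then have "AE r in mult_haar. ennpowr (\<integral>\<^sup>+\<theta>. ennpowr (g (r *\<^sub>R \<theta>)) q \<partial>sphere_measure) (p / q) * ennreal (r powr a) \<noteq> \<infinity>"
    by (rule nn_integral_PInf_AE[rotated]) (subst measurable_cong_sets[OF sets_mult_haar refl], measurable)
  then have "AE r in mult_haar. AE \<theta> in sphere_measure. g (r *\<^sub>R \<theta>) < top"
    using AE_mult_haar_pos
  proof eventually_elim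
    case (elim r)
    then have "(\<integral>\<^sup>+\<theta>. ennpowr (g (r *\<^sub>R \<theta>)) q \<partial>sphere_measure) \<noteq> \<infinity>"
      by (auto simp: ennreal_top_mult)
    then have "AE \<theta> in sphere_measure. ennpowr (g (r *\<^sub>R \<theta>)) q \<noteq> \<infinity>"
      by (rule nn_integral_PInf_AE[rotated]) measurable
    then show ?case
      by eventually_elim (simp add: less_top)
  qed
  then show ?thesis
    by (subst (asm) AE_polar_iff) auto
qed

text \<open>The common core of (a) and (b). The bound \<open>R\<close> is left abstract so that
  either right-hand side can be inserted, and its finiteness is what yields integrability.\<close>

lemma hausdorff_op_bound:
  fixes \<Phi> f :: "'a::euclidean_space \<Rightarrow> complex"
  assumes \<Phi>: "\<Phi> \<in> borel_measurable lebesgue" and f: "f \<in> borel_measurable lebesgue"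
    and "1 \<le> p\<^sub>1" "1 \<le> p\<^sub>2" "1 \<le> q" "1 \<le> s" "q \<le> p\<^sub>2"
    and scaling: "(\<gamma> + real DIM('a)) / p\<^sub>2 = (\<alpha> + real DIM('a)) / p\<^sub>1 - \<beta>"
    and exps: "1 / p\<^sub>2 + 1 = 1 / s + 1 / p\<^sub>1"
    and bound: "ang_rad_norm q s (\<lambda>r. r powr ((\<gamma> + real DIM('a)) * s / p\<^sub>2 - real DIM('a))) \<Phi>
      * rad_ang_norm p\<^sub>1 1 (\<lambda>r. r powr \<alpha>) f \<le> R"
    and "R < top"
  shows "(AE x in lebesgue. integrable lebesgue (hausdorff_integrand \<Phi> \<beta> f x))
    \<and> rad_ang_norm p\<^sub>2 q (\<lambda>r. r powr \<gamma>) (hausdorff_op \<Phi> \<beta> f) \<le> R"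
proof -
  obtain \<Phi>' where \<Phi>'_meas: "\<Phi>' \<in> borel_measurable lborel" and \<Phi>': "AE x in lborel. \<Phi> x = \<Phi>' x"
    by (rule completion_ex_borel_measurable_complex[OF \<Phi>])
  obtain f' where f'_meas: "f' \<in> borel_measurable lborel" and f': "AE x in lborel. f x = f' x"
    by (rule completion_ex_borel_measurable_complex[OF f])
  have [measurable]: "\<Phi>' \<in> borel_measurable borel" "f' \<in> borel_measurable borel"
    using \<Phi>'_meas f'_meas by simp_all
  define g where "g x = ennreal (norm (\<Phi>' x))" for x
  define u where "u x = ennreal (norm (f' x))" for x
  have [measurable]: "g \<in> borel_measurable borel" "u \<in> borel_measurable borel"
    unfolding g_def[abs_def] u_def[abs_def] by measurable
  define K where "K = hausdorff_majorant g \<beta> u"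
  have [measurable]: "K \<in> borel_measurable borel"
    unfolding K_def by measurable
  have K: "K x = (\<integral>\<^sup>+y. ennreal (norm (hausdorff_integrand \<Phi>' \<beta> f' x y)) \<partial>lborel)" for x
    by (simp add: K_def hausdorff_majorant_def ennreal_norm_hausdorff_integrand g_def u_def)
  have good: "AE \<theta> in sphere_measure. \<forall>r>0.
      AE y in lborel. hausdorff_integrand \<Phi> \<beta> f (r *\<^sub>R \<theta>) y = hausdorff_integrand \<Phi>' \<beta> f' (r *\<^sub>R \<theta>) y"
    by (rule AE_hausdorff_integrand_cong[OF \<Phi>' f'])
  \<comment> \<open>The exponent relation forces both inequalities, because \<open>1 / s\<close> and
    \<open>1 / p\<^sub>1\<close> are at most 1.\<close>
  have le: "p\<^sub>1 \<le> p\<^sub>2" "s \<le> p\<^sub>2"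
  proof -
    have "1 / s \<le> 1" "1 / p\<^sub>1 \<le> 1"
      using assms by auto
    then have "1 / p\<^sub>2 \<le> 1 / p\<^sub>1" "1 / p\<^sub>2 \<le> 1 / s"
      using exps by linarith+
    then show "p\<^sub>1 \<le> p\<^sub>2" "s \<le> p\<^sub>2"
      using assms by (auto simp: field_simps)
  qed
  have "rad_ang_norm p\<^sub>2 q (\<lambda>r. r powr \<gamma>) (hausdorff_op \<Phi> \<beta> f) \<le> haar_rad_ang p\<^sub>2 q (\<gamma> + real DIM('a)) K"
  proof (rule rad_ang_norm_le_haar)
    show "AE r in mult_haar. AE \<theta> in sphere_measure. ennreal (norm (hausdorff_op \<Phi> \<beta> f (r *\<^sub>R \<theta>))) \<le> K (r *\<^sub>R \<theta>)"
      using AE_mult_haar_pos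
    proof (rule eventually_mono)
      fix r :: real assume "0 < r"
      show "AE \<theta> in sphere_measure. ennreal (norm (hausdorff_op \<Phi> \<beta> f (r *\<^sub>R \<theta>))) \<le> K (r *\<^sub>R \<theta>)"
        using good
      proof eventually_elim
        case (elim \<theta>)
        have "ennreal (norm (hausdorff_op \<Phi> \<beta> f (r *\<^sub>R \<theta>)))
            \<le> (\<integral>\<^sup>+y. ennreal (norm (hausdorff_integrand \<Phi> \<beta> f (r *\<^sub>R \<theta>) y)) \<partial>lebesgue)"
          unfolding hausdorff_op_def by (rule norm_integral_le_nn_integral)
        also have "\<dots> = (\<integral>\<^sup>+y. ennreal (norm (hausdorff_integrand \<Phi> \<beta> f (r *\<^sub>R \<theta>) y)) \<partial>lborel)"
          by (rule nn_integral_completion)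
        also have "\<dots> = K (r *\<^sub>R \<theta>)"
          unfolding K
        proof (rule nn_integral_cong_AE)
          show "AE y in lborel. ennreal (norm (hausdorff_integrand \<Phi> \<beta> f (r *\<^sub>R \<theta>) y))
              = ennreal (norm (hausdorff_integrand \<Phi>' \<beta> f' (r *\<^sub>R \<theta>) y))"
            using elim[rule_format, OF \<open>0 < r\<close>] by eventually_elim simp
        qed
        finally show ?case .
      qed
    qed
  qed (use assms in auto)
  \<comment> \<open>Used twice: it completes the norm estimate and, \<open>R\<close> being finite,
    makes \<open>K\<close> finite almost everywhere.\<close>
  also have K_le: "haar_rad_ang p\<^sub>2 q (\<gamma> + real DIM('a)) K \<le> R"
  proof -
    have "haar_rad_ang p\<^sub>2 q (\<gamma> + real DIM('a)) K
        \<le> haar_ang_rad q s ((\<gamma> + real DIM('a)) * s / p\<^sub>2) g * haar_rad_ang p\<^sub>1 1 (\<alpha> + real DIM('a)) u"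
      unfolding K_def using assms le by (intro hausdorff_majorant_bound) auto
    also have "haar_ang_rad q s ((\<gamma> + real DIM('a)) * s / p\<^sub>2) g
        = ang_rad_norm q s (\<lambda>r. r powr ((\<gamma> + real DIM('a)) * s / p\<^sub>2 - real DIM('a))) \<Phi>"
    proof -
      have "AE x in lborel. ennreal (norm (\<Phi> x)) = g x"
        using \<Phi>' by eventually_elim (simp add: g_def)
      then show ?thesis
        by (subst ang_rad_norm_eq_haar[where g = g]) simp_all
    qed
    also have "haar_rad_ang p\<^sub>1 1 (\<alpha> + real DIM('a)) u = rad_ang_norm p\<^sub>1 1 (\<lambda>r. r powr \<alpha>) f"
    proof -
      have "AE x in lborel. ennreal (norm (f x)) = u x"
        using f' by eventually_elim (simp add: u_def)
      then show ?thesis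
        by (subst rad_ang_norm_eq_haar[where g = u]) simp_all
    qed
    finally show ?thesis
      using bound by simp
  qed
  finally have *: "rad_ang_norm p\<^sub>2 q (\<lambda>r. r powr \<gamma>) (hausdorff_op \<Phi> \<beta> f) \<le> R" .
  have "AE x in lborel. K x < top"
    using K_le \<open>R < top\<close> by (intro haar_rad_ang_finite_imp_AE_finite[of K p\<^sub>2 q "\<gamma> + real DIM('a)"]) auto
  then have "AE x in lborel. integrable lebesgue (hausdorff_integrand \<Phi> \<beta> f x)"
    using AE_sphere_imp_AE_sgn[OF good] AE_lborel_singleton[of 0]
  proof eventually_elim
    case (elim x)
    have "hausdorff_integrand \<Phi>' \<beta> f' x \<in> borel_measurable borel"
      unfolding hausdorff_integrand_def[abs_def] by measurable
    then have meas: "hausdorff_integrand \<Phi>' \<beta> f' x \<in> borel_measurable lborel"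
      by simp
    then have "integrable lborel (hausdorff_integrand \<Phi>' \<beta> f' x)"
      using elim(1) by (simp add: integrable_iff_bounded K)
    then have int: "integrable lebesgue (hausdorff_integrand \<Phi>' \<beta> f' x)"
      using meas by (simp add: integrable_completion)
    \<comment> \<open>Writing \<open>x\<close> as radius times direction reduces the exceptional
      points to the exceptional directions.\<close>
    have "norm x *\<^sub>R sgn x = x"
      using elim(3) by (simp add: sgn_div_norm)
    then have eq: "AE y in lborel. hausdorff_integrand \<Phi> \<beta> f x y = hausdorff_integrand \<Phi>' \<beta> f' x y"
      using elim(2)[rule_format, of "norm x"] elim(3) by simp
    \<comment> \<open>For a given \<open>x\<close> the integrand sees \<Phi> only on a ray, which is
      a null set in dimension at least 2, so measurability in \<open>y\<close> does not follow from
      that of \<Phi>. It is inherited from the Borel version for almost every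
      \<open>x\<close>.\<close>
    then have "hausdorff_integrand \<Phi> \<beta> f x \<in> borel_measurable lebesgue"
      using meas by (rule measurable_completion_cong_AE[rotated])
    then show ?case
      using int AE_completion[OF eq] by (subst integrable_cong_AE) auto
  qed
  with * show ?thesis
    by (auto intro: AE_completion)
qed

theorem theorem3p1:
  fixes \<Phi> :: "real ^ 'n \<Rightarrow> complex"
    and \<alpha> \<beta> \<gamma> p\<^sub>1 p\<^sub>2 q s :: real
  assumes "CARD('n) \<ge> 2"
    and "0 \<le> \<beta>" "\<beta> < real CARD('n)"
    and "1 \<le> p\<^sub>1" "1 \<le> p\<^sub>2" "1 \<le> q" "1 \<le> s"
    and "q \<le> p\<^sub>2"
    and "(\<gamma> + real CARD('n)) / p\<^sub>2 = (\<alpha> + real CARD('n)) / p\<^sub>1 - \<beta>"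
    and "1 / p\<^sub>2 + 1 = 1 / s + 1 / p\<^sub>1"
    and "\<Phi> \<in> borel_measurable lebesgue"
  shows
    "(\<forall>f \<in> borel_measurable lebesgue.
       ang_rad_norm q s (\<lambda>r. r powr ((\<gamma> + real CARD('n)) * s / p\<^sub>2 - real CARD('n))) \<Phi>
         * ang_rad_norm 1 p\<^sub>1 (\<lambda>r. r powr \<alpha>) f < \<infinity> \<longrightarrow>
       (AE x in lebesgue. integrable lebesgue (hausdorff_integrand \<Phi> \<beta> f x)) \<and>
       rad_ang_norm p\<^sub>2 q (\<lambda>r. r powr \<gamma>) (hausdorff_op \<Phi> \<beta> f)
         \<le> ang_rad_norm q s (\<lambda>r. r powr ((\<gamma> + real CARD('n)) * s / p\<^sub>2 - real CARD('n))) \<Phi>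
             * ang_rad_norm 1 p\<^sub>1 (\<lambda>r. r powr \<alpha>) f)
   \<and>
    (\<forall>f \<in> borel_measurable lebesgue.
       ang_rad_norm q s (\<lambda>r. r powr ((\<gamma> + real CARD('n)) * s / p\<^sub>2 - real CARD('n))) \<Phi>
         * rad_ang_norm p\<^sub>1 q (\<lambda>r. r powr \<alpha>) f < \<infinity> \<longrightarrow>
       (AE x in lebesgue. integrable lebesgue (hausdorff_integrand \<Phi> \<beta> f x)) \<and>
       rad_ang_norm p\<^sub>2 q (\<lambda>r. r powr \<gamma>) (hausdorff_op \<Phi> \<beta> f)
         \<le> sphere_embedding_const TYPE(real ^ 'n) q
             * (ang_rad_norm q s (\<lambda>r. r powr ((\<gamma> + real CARD('n)) * s / p\<^sub>2 - real CARD('n))) \<Phi>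
                 * rad_ang_norm p\<^sub>1 q (\<lambda>r. r powr \<alpha>) f))"
proof -
  define N where "N = ang_rad_norm q s (\<lambda>r. r powr ((\<gamma> + real CARD('n)) * s / p\<^sub>2 - real CARD('n))) \<Phi>"
  have main: "(AE x in lebesgue. integrable lebesgue (hausdorff_integrand \<Phi> \<beta> f x)) \<and>
      rad_ang_norm p\<^sub>2 q (\<lambda>r. r powr \<gamma>) (hausdorff_op \<Phi> \<beta> f) \<le> R"
    if "f \<in> borel_measurable lebesgue" "N * rad_ang_norm p\<^sub>1 1 (\<lambda>r. r powr \<alpha>) f \<le> R" "R < top" for f R
    by (rule hausdorff_op_bound[where \<alpha> = \<alpha> and p\<^sub>1 = p\<^sub>1 and s = s]) (use assms that in \<open>simp_all add: N_def\<close>)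
  \<comment> \<open>Both comparisons are proved for a Borel version \<open>u\<close> of the modulus,
    which has the same mixed norms as \<open>f\<close>.\<close>
  have norms: "rad_ang_norm p\<^sub>1 1 (\<lambda>r. r powr \<alpha>) f \<le> ang_rad_norm 1 p\<^sub>1 (\<lambda>r. r powr \<alpha>) f"
      "rad_ang_norm p\<^sub>1 1 (\<lambda>r. r powr \<alpha>) f
        \<le> sphere_embedding_const TYPE(real ^ 'n) q * rad_ang_norm p\<^sub>1 q (\<lambda>r. r powr \<alpha>) f"
    if f: "f \<in> borel_measurable lebesgue" for f :: "real ^ 'n \<Rightarrow> complex"
  proof -
    obtain u where [measurable]: "u \<in> borel_measurable borel" and u: "AE x in lborel. ennreal (norm (f x)) = u x"
      using completion_ex_borel_measurable[of "\<lambda>x. ennreal (norm (f x))" lborel] f by auto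
    show "rad_ang_norm p\<^sub>1 1 (\<lambda>r. r powr \<alpha>) f \<le> ang_rad_norm 1 p\<^sub>1 (\<lambda>r. r powr \<alpha>) f"
      "rad_ang_norm p\<^sub>1 1 (\<lambda>r. r powr \<alpha>) f
        \<le> sphere_embedding_const TYPE(real ^ 'n) q * rad_ang_norm p\<^sub>1 q (\<lambda>r. r powr \<alpha>) f"
      using assms
      by (simp_all add: rad_ang_norm_eq_haar[OF _ u] ang_rad_norm_eq_haar[OF _ u]
          haar_rad_ang_le_ang_rad haar_rad_ang_one_le)
  qed
  have a: "(AE x in lebesgue. integrable lebesgue (hausdorff_integrand \<Phi> \<beta> f x)) \<and>
      rad_ang_norm p\<^sub>2 q (\<lambda>r. r powr \<gamma>) (hausdorff_op \<Phi> \<beta> f) \<le> N * ang_rad_norm 1 p\<^sub>1 (\<lambda>r. r powr \<alpha>) f"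
    if f: "f \<in> borel_measurable lebesgue" and "N * ang_rad_norm 1 p\<^sub>1 (\<lambda>r. r powr \<alpha>) f < \<infinity>" for f
    using that norms[OF f] by (intro main mult_left_mono) auto
  have b: "(AE x in lebesgue. integrable lebesgue (hausdorff_integrand \<Phi> \<beta> f x)) \<and>
      rad_ang_norm p\<^sub>2 q (\<lambda>r. r powr \<gamma>) (hausdorff_op \<Phi> \<beta> f)
        \<le> sphere_embedding_const TYPE(real ^ 'n) q * (N * rad_ang_norm p\<^sub>1 q (\<lambda>r. r powr \<alpha>) f)"
    if f: "f \<in> borel_measurable lebesgue" and fin: "N * rad_ang_norm p\<^sub>1 q (\<lambda>r. r powr \<alpha>) f < \<infinity>" for f
  proof (rule main[OF f])
    show "N * rad_ang_norm p\<^sub>1 1 (\<lambda>r. r powr \<alpha>) f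
        \<le> sphere_embedding_const TYPE(real ^ 'n) q * (N * rad_ang_norm p\<^sub>1 q (\<lambda>r. r powr \<alpha>) f)"
      using mult_left_mono[OF norms(2)[OF f], of N] by (simp add: mult.left_commute)
    \<comment> \<open>The hypothesis of (b) gives finiteness only of the product of norms; the
      embedding constant is a real number and preserves it.\<close>
    show "sphere_embedding_const TYPE(real ^ 'n) q * (N * rad_ang_norm p\<^sub>1 q (\<lambda>r. r powr \<alpha>) f) < top"
      using fin by (simp add: sphere_embedding_const_def ennreal_mult_less_top)
  qed
  show ?thesis
    using a b unfolding N_def by blast
qed

end
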